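(* There exists a continuous function $f:(-\infty,0]\to[0,+\infty)$ with $f(x)=0$ if and only if $x=0$, such that the following holds for every connected, compact and metrizable topological abelian group $G$, equipped with its Borel $\sigma$-algebra, and all independent random variables $X,Y$ on $G$ with finite entropies: $$h(X+Y)-\frac12h(X)-\frac12h(Y)\geq\max\{f(h(X)),f(h(Y))\}.$$ In fact, we may take $$f(x)=\begin{cases}\dfrac{-x^5-4x^6}{16+8x^4}&\text{if }-\frac18\leq x\leq0,\\[2mm] f(-\frac18)&\text{if }x<-\frac18.\end{cases}$$
   Context: Let $\mu$ be the unique Haar probability measure on $G$. For a $G$-valued random variable $X$, the entropy is $h(X):=-\int_G g\log g\,d\mu$ if the law of $X$ has a density $g$ with respect to $\mu$, and $h(X):=-\infty$ otherwise ($\log$ is the natural logarithm); one always has $h(X)\in[-\infty,0]$. "Finite entropy" means $h(X)>-\infty$. *)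

theory Defs
  imports "HOL-Probability.Probability"
begin

definition haar_prob :: "'g::topological_ab_group_add measure \<Rightarrow> bool" where
  "haar_prob \<mu> \<longleftrightarrow>
     prob_space \<mu> \<and> sets \<mu> = sets borel \<and> (\<forall>a. distr \<mu> borel (\<lambda>x. a + x) = \<mu>)"

(* The extended-real-valued integral of a real function, as the difference of the integrals of the
   positive and the negative part (ennreal maps negative reals to 0).  It is only used for integrands
   bounded from below over a probability space, so the second term is finite and no
   \<infinity> - \<infinity> arises. *)
definition ext_integral :: "'a measure \<Rightarrow> ('a \<Rightarrow> real) \<Rightarrow> ereal" where
  "ext_integral \<mu> f =
     enn2ereal (\<integral>\<^sup>+x. ennreal (f x) \<partial>\<mu>) - enn2ereal (\<integral>\<^sup>+x. ennreal (- f x) \<partial>\<mu>)"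

(* RN_deriv selects a density of the law whenever there is one; by law_entropy_density below the
   selection does not matter.  The convention 0 log 0 = 0 holds since multiplication by 0 gives 0. *)
definition law_entropy :: "'g measure \<Rightarrow> 'g measure \<Rightarrow> ereal" where
  "law_entropy \<mu> \<nu> =
     (if \<exists>g \<in> borel_measurable \<mu>. \<nu> = density \<mu> g
      then - ext_integral \<mu> (\<lambda>x. enn2real (RN_deriv \<mu> \<nu> x) * ln (enn2real (RN_deriv \<mu> \<nu> x)))
      else - \<infinity>)"

definition entropy_wrt :: "'g measure \<Rightarrow> 'w measure \<Rightarrow> ('w \<Rightarrow> 'g) \<Rightarrow> ereal" where
  "entropy_wrt \<mu> M X = law_entropy \<mu> (distr M \<mu> X)"

definition gap_formula :: "real \<Rightarrow> real" where
  "gap_formula x = (- (x ^ 5) - 4 * x ^ 6) / (16 + 8 * x ^ 4)"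

(* Only the values on the half-line x \<le> 0 are meaningful. *)
definition gap :: "real \<Rightarrow> real" where
  "gap x = (if - 1 / 8 \<le> x then gap_formula x else gap_formula (- 1 / 8))"

lemma law_entropy_density:
  assumes "prob_space \<mu>" "g \<in> borel_measurable \<mu>" "\<And>x. 0 \<le> g x"
    and "\<nu> = density \<mu> (\<lambda>x. ennreal (g x))"
  shows "law_entropy \<mu> \<nu> = - ext_integral \<mu> (\<lambda>x. g x * ln (g x))"
proof -
  interpret prob_space \<mu> by fact
  have m: "(\<lambda>x. ennreal (g x)) \<in> borel_measurable \<mu>"
    using assms(2) by measurable
  have "AE x in \<mu>. ennreal (g x) = RN_deriv \<mu> \<nu> x"
    using RN_deriv_unique[OF m] assms(4) by simp
  then have ae: "AE x in \<mu>. enn2real (RN_deriv \<mu> \<nu> x) = g x"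
    by eventually_elim (metis assms(3) enn2real_ennreal)
  have "(\<integral>\<^sup>+x. ennreal (enn2real (RN_deriv \<mu> \<nu> x) * ln (enn2real (RN_deriv \<mu> \<nu> x))) \<partial>\<mu>)
      = (\<integral>\<^sup>+x. ennreal (g x * ln (g x)) \<partial>\<mu>)"
    by (rule nn_integral_cong_AE) (use ae in eventually_elim, simp)
  moreover have "(\<integral>\<^sup>+x. ennreal (- (enn2real (RN_deriv \<mu> \<nu> x) * ln (enn2real (RN_deriv \<mu> \<nu> x)))) \<partial>\<mu>)
      = (\<integral>\<^sup>+x. ennreal (- (g x * ln (g x))) \<partial>\<mu>)"
    by (rule nn_integral_cong_AE) (use ae in eventually_elim, simp)
  moreover have "\<exists>g \<in> borel_measurable \<mu>. \<nu> = density \<mu> g"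
    using m assms(4) by blast
  ultimately show ?thesis
    by (simp add: law_entropy_def ext_integral_def)
qed

end

theory Submission
  imports Defs
begin

(* Let f, g be the densities of X, Y, let r = f * g be that of X + Y, and let D denote relative
   entropy with respect to mu, so that h = - D.  Suppose that (D f + D g) / 2 - D r is tiny.
   Since D f - D r is a mutual information, a Pinsker-type inequality shows that the translate of f
   by y is L1-close to r for all y outside a set of small g-mass, and symmetrically for g.  Hence a
   z that moves g by at most 1/2 in L1 moves f by at most a much smaller s, and vice versa; so the z
   that move f by at most 1/2 form a subgroup of positive measure.  Such a subgroup is open, hence
   is G by connectedness, and averaging over G gives that f is L1-close to 1.  If f exceeds 1 only by
   a mass p, then D r <= p (1 + D g), which contradicts D r being close to D g unless D g is of
   the size of p.  This argument gives the gap s^2 / 8192 with s = min (max (D f) (D g)) (1/8),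
   which is larger than the claimed one. *)

text \<open>Connectedness creates the gap: if X and Y are uniform on a proper open subgroup, then
  h(X+Y) - h(X)/2 - h(Y)/2 = 0 although h(X) < 0. Near equality must therefore be turned into an
  open subgroup. The jump in radius does this: a detour through the other density improves 1/2 to s
  <= 1/8, and 2 s <= 1/2 then gives closure under differences. L1-closeness of f to 1 does not bound
  D f, since f may be huge on a tiny set. Hence D f and D g are compared with D r, where convolution
  with g has smeared out the excess of f. The Pinsker-type inequality is kept linear with a free
  parameter l: the L1 distance enters with factor l, at the cost of an error l^2. In this form it
  can be integrated over both variables without square roots, and l = s/64 is chosen only at the
  end.\<close>

section \<open>Borel sets of compact metric spaces\<close>

text \<open>Total boundedness gives a finite net at every scale 1/(n+1); the balls of that radius
  around the net points form the base. The type class does not provide second countability, so it is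
  drawn from compactness.\<close>

lemma compact_metric_countable_base:
  assumes "compact (UNIV :: 'a::metric_space set)"
  obtains \<B> :: "'a::metric_space set set" where "countable \<B>" "\<And>B. B \<in> \<B> \<Longrightarrow> open B"
    "\<And>U x. open U \<Longrightarrow> x \<in> U \<Longrightarrow> \<exists>B\<in>\<B>. x \<in> B \<and> B \<subseteq> U"
proof -
  have "\<forall>n. \<exists>k. finite k \<and> UNIV \<subseteq> (\<Union>x\<in>k. ball x (1 / real (Suc n)) :: 'a set)"
    using assms unfolding compact_eq_totally_bounded by simp
  then obtain K where fin: "\<And>n. finite (K n)"
    and cov: "\<And>n. UNIV \<subseteq> (\<Union>x\<in>K n. ball x (1 / real (Suc n)) :: 'a set)" by metis
  define \<B> where "\<B> = (\<Union>n. (\<lambda>x. ball x (1 / real (Suc n))) ` K n)"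
  show thesis
  proof
    show "countable \<B>"
      by (simp add: \<B>_def countable_finite fin)
    show "open B" if "B \<in> \<B>" for B using that by (auto simp: \<B>_def)
    show "\<exists>B\<in>\<B>. x \<in> B \<and> B \<subseteq> U" if U: "open U" and x: "x \<in> U" for U and x :: 'a
    proof -
      obtain e where e: "e > 0" "ball x e \<subseteq> U" using U x by (meson open_contains_ball)
      obtain n where n: "1 / real (Suc n) < e / 2"
        using nat_approx_posE[of "e/2"] e by (metis half_gt_zero)
      obtain y where y: "y \<in> K n" "x \<in> ball y (1 / real (Suc n))" using cov[of n] by blast
      have "ball y (1 / real (Suc n)) \<subseteq> ball x e"
      proof
        fix z assume "z \<in> ball y (1 / real (Suc n))"
        then have "dist x z < 1 / real (Suc n) + 1 / real (Suc n)"
          using y(2) dist_triangle[of x z y] by (simp add: dist_commute)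
        then show "z \<in> ball x e" using n by simp
      qed
      then show ?thesis using y e by (auto simp: \<B>_def)
    qed
  qed
qed

text \<open>An open set of the product is a countable union of base rectangles. This is what makes
  addition measurable for the product sigma-algebra.\<close>

lemma compact_metric_open_in_borel_pair:
  fixes W :: "('a::metric_space \<times> 'a) set"
  assumes "compact (UNIV :: 'a set)" "open W"
  shows "W \<in> sets (borel \<Otimes>\<^sub>M borel)"
proof -
  obtain \<B> :: "'a set set" where B: "countable \<B>" "\<And>B. B \<in> \<B> \<Longrightarrow> open B"
    "\<And>U x. open U \<Longrightarrow> x \<in> U \<Longrightarrow> \<exists>B\<in>\<B>. x \<in> B \<and> B \<subseteq> U"
    by (fact compact_metric_countable_base[OF assms(1)])
  define R where "R = {p \<in> \<B> \<times> \<B>. fst p \<times> snd p \<subseteq> W}"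
  have "W = (\<Union>p\<in>R. fst p \<times> snd p)"
  proof safe
    fix a b assume "(a, b) \<in> W"
    then obtain A C where AC: "open A" "open C" "a \<in> A" "b \<in> C" "A \<times> C \<subseteq> W"
      using assms(2) unfolding open_prod_def by fastforce
    obtain A' where A': "A' \<in> \<B>" "a \<in> A'" "A' \<subseteq> A" using B(3)[OF AC(1,3)] by blast
    obtain C' where C': "C' \<in> \<B>" "b \<in> C'" "C' \<subseteq> C" using B(3)[OF AC(2,4)] by blast
    have "(A', C') \<in> R" using A' C' AC(5) by (auto simp: R_def)
    then show "(a, b) \<in> (\<Union>p\<in>R. fst p \<times> snd p)" using A' C' by force
  qed (auto simp: R_def)
  moreover have "(\<Union>p\<in>R. fst p \<times> snd p) \<in> sets (borel \<Otimes>\<^sub>M borel)"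
  proof (rule sets.countable_UN')
    show "countable R"
      by (rule countable_subset[of _ "\<B> \<times> \<B>"]) (use B(1) in \<open>auto simp: R_def\<close>)
  qed (auto simp: R_def B(2))
  ultimately show ?thesis by simp
qed

lemma compact_metric_continuous_pair_measurable:
  fixes f :: "'a::metric_space \<times> 'a \<Rightarrow> 'b::topological_space"
  assumes "compact (UNIV :: 'a set)" "continuous_on UNIV f"
  shows "f \<in> borel_measurable (borel \<Otimes>\<^sub>M borel)"
proof (rule borel_measurableI)
  fix S :: "'b set" assume "open S"
  then have "open (f -` S)" using assms(2) by (rule open_vimage)
  then show "f -` S \<inter> space (borel \<Otimes>\<^sub>M borel) \<in> sets (borel \<Otimes>\<^sub>M borel)"
    using compact_metric_open_in_borel_pair[OF assms(1)] by (simp add: space_pair_measure)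
qed

lemma closed_open_approx:
  fixes M :: "'a::metric_space measure"
  assumes "finite_measure M" "sets M = sets borel" "closed C" "0 < e"
  shows "\<exists>U. open U \<and> C \<subseteq> U \<and> measure M (U - C) < e"
\<comment> \<open>By convention \<open>infdist x {}\<close> is 0, so the neighbourhoods used below
  would not shrink to the empty set.\<close>
proof (cases "C = {}")
  case True
  then show ?thesis using assms by (intro exI[of _ "{}"]) auto
next
  case False
  interpret finite_measure M by fact
  define U where "U n = {x. infdist x C < 1 / real (Suc n)}" for n
  have opU: "open (U n)" for n
    unfolding U_def by (intro open_Collect_less continuous_intros)
  have CU: "C \<subseteq> U n" for n by (auto simp: U_def)
  have "range (\<lambda>n. U n - C) \<subseteq> sets M"
    using opU assms(2,3) by auto
  moreover have "decseq (\<lambda>n. U n - C)"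
  proof (rule decseq_SucI)
    fix n
    have "1 / real (Suc (Suc n)) \<le> 1 / real (Suc n)" by (simp add: field_simps)
    then show "U (Suc n) - C \<subseteq> U n - C" unfolding U_def by fastforce
  qed
  ultimately have "(\<lambda>n. measure M (U n - C)) \<longlonglongrightarrow> measure M (\<Inter>n. U n - C)"
    by (rule finite_Lim_measure_decseq)
  moreover have "(\<Inter>n. U n - C) = {}"
  proof (rule ccontr)
    assume "(\<Inter>n. U n - C) \<noteq> {}"
    then obtain x where x: "\<And>n. x \<in> U n" "x \<notin> C" by auto
    have "infdist x C > 0"
      using x(2) assms(3) False infdist_nonneg[of x C] in_closed_iff_infdist_zero by fastforce
    then obtain n where "1 / real (Suc n) < infdist x C" by (rule nat_approx_posE)
    then show False using x(1)[of n] by (simp add: U_def)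
  qed
  ultimately have "(\<lambda>n. measure M (U n - C)) \<longlonglongrightarrow> 0"
    by (simp only: measure_empty)
  then have "eventually (\<lambda>n. measure M (U n - C) < e) sequentially"
    using assms(4) by (rule order_tendstoD)
  then obtain n where "measure M (U n - C) < e" by (auto simp: eventually_sequentially)
  then show ?thesis using opU CU by blast
qed

text \<open>The sets with such approximations form a sigma-algebra, which contains the closed sets
  by \<open>closed_open_approx\<close>.\<close>

lemma borel_closed_open_approx:
  fixes M :: "'a::metric_space measure"
  assumes "finite_measure M" "sets M = sets borel" "B \<in> sets borel" "0 < e"
  shows "\<exists>C U. closed C \<and> open U \<and> C \<subseteq> B \<and> B \<subseteq> U \<and> measure M (U - C) < e"
proof -
  interpret finite_measure M by fact
  define P where "P B \<longleftrightarrow> (\<forall>e>0. \<exists>C U. closed C \<and> open U \<and> C \<subseteq> B \<and> B \<subseteq> U \<and> measure M (U - C) < e)"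
    for B
  have "B \<in> sigma_sets UNIV (Collect closed)"
    using assms(3) by (simp add: borel_eq_closed)
  then have "P B"
  proof (induction rule: sigma_sets.induct)
    case (Basic C)
    then have "closed C" by simp
    then show ?case unfolding P_def using closed_open_approx[OF assms(1,2), of C]
      by (meson order_refl)
  next
    case Empty
    show ?case unfolding P_def
      by (intro allI impI, rule exI[of _ "{}"], rule exI[of _ "{}"]) simp
  next
    case (Compl B)
    show ?case unfolding P_def
    proof (intro allI impI)
      fix e :: real assume e: "0 < e"
      obtain C U where CU: "closed C" "open U" "C \<subseteq> B" "B \<subseteq> U" "measure M (U - C) < e"
        using Compl.IH[unfolded P_def, rule_format, OF e] by blast
      have "- C - - U = U - C" by auto
      with CU show "\<exists>C' U'. closed C' \<and> open U' \<and> C' \<subseteq> UNIV - B \<and> UNIV - B \<subseteq> U' \<and> measure M (U' - C') < e"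
        by (intro exI[of _ "- U"] exI[of _ "- C"] conjI) auto
    qed
  next
    case (Union A)
    show ?case unfolding P_def
    proof (intro allI impI)
      fix e :: real assume e: "0 < e"
      \<comment> \<open>These errors add up to e/2. A further e/4 pays for replacing the union of
        all \<open>C n\<close>, which need not be closed, by a finite union.\<close>
      have "\<forall>n. \<exists>C U. closed C \<and> open U \<and> C \<subseteq> A n \<and> A n \<subseteq> U \<and> measure M (U - C) < e / 4 * (1/2) ^ n"
        proof
          fix n
          have "0 < e / 4 * (1/2) ^ n" using e by simp
          from Union.IH[unfolded P_def, rule_format, OF this, of n] show "\<exists>C U. closed C \<and> open U \<and> C \<subseteq> A n \<and> A n \<subseteq> U \<and> measure M (U - C) < e / 4 * (1/2) ^ n"
            .
        qed
      then obtain C U where CU: "\<And>n. closed (C n)" "\<And>n. open (U n)" "\<And>n. C n \<subseteq> A n"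
        "\<And>n. A n \<subseteq> U n" "\<And>n. measure M (U n - C n) < e / 4 * (1/2) ^ n"
        by metis
      have [measurable]: "C n \<in> sets M" "U n \<in> sets M" for n using CU(1,2) assms(2) by auto
      define F where "F N = (\<Union>n\<le>N. C n)" for N
      have clF: "closed (F N)" for N unfolding F_def using CU(1) by auto
      have Fm [measurable]: "F N \<in> sets M" for N using clF assms(2) by auto
      have "(\<lambda>N. measure M (F N)) \<longlonglongrightarrow> measure M (\<Union>N. F N)"
        by (rule finite_Lim_measure_incseq)
          (auto simp: F_def incseq_def, meson atMost_iff order_trans)
      moreover have "(\<Union>N. F N) = (\<Union>n. C n)" by (auto simp: F_def)
      ultimately have "(\<lambda>N. measure M (F N)) \<longlonglongrightarrow> measure M (\<Union>n. C n)" by simp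
      then have "eventually (\<lambda>N. measure M (\<Union>n. C n) - e/4 < measure M (F N)) sequentially"
        using e by (intro order_tendstoD) auto
      then obtain N where N: "measure M (\<Union>n. C n) - e/4 < measure M (F N)"
        by (auto simp: eventually_sequentially)
      have sm: "summable (\<lambda>n. e / 4 * (1/2::real) ^ n)" by (intro summable_mult summable_geometric) auto
      have sm': "summable (\<lambda>n. measure M (U n - C n))"
        by (rule summable_comparison_test[OF _ sm]) (use CU(5) in \<open>auto intro!: exI[of _ 0] less_imp_le\<close>)
      have "measure M ((\<Union>n. U n) - (\<Union>n. C n)) \<le> measure M (\<Union>n. U n - C n)"
        by (rule finite_measure_mono) auto
      also have "\<dots> \<le> (\<Sum>n. measure M (U n - C n))"
        by (rule finite_measure_subadditive_countably[OF _ sm']) auto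
      also have "\<dots> \<le> (\<Sum>n. e / 4 * (1/2) ^ n)"
        by (rule suminf_le[OF _ sm' sm]) (use CU(5) less_imp_le in blast)
      also have "\<dots> = e / 2"
        using sums_unique[OF sums_mult[OF geometric_sums[of "1/2::real"]], of "e/4"] by simp
      finally have 1: "measure M ((\<Union>n. U n) - (\<Union>n. C n)) \<le> e / 2" .
      have "measure M ((\<Union>n. C n) - F N) = measure M (\<Union>n. C n) - measure M (F N)"
        by (rule finite_measure_Diff) (auto simp: F_def)
      then have 2: "measure M ((\<Union>n. C n) - F N) < e / 4" using N by simp
      have "measure M ((\<Union>n. U n) - F N) \<le> measure M (((\<Union>n. U n) - (\<Union>n. C n)) \<union> ((\<Union>n. C n) - F N))"
        by (rule finite_measure_mono) auto
      also have "\<dots> \<le> measure M ((\<Union>n. U n) - (\<Union>n. C n)) + measure M ((\<Union>n. C n) - F N)"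
        by (intro measure_subadditive) auto
      also have "\<dots> < e" using 1 2 e by simp
      finally have "measure M ((\<Union>n. U n) - F N) < e" .
      moreover have "F N \<subseteq> (\<Union>n. A n)" "(\<Union>n. A n) \<subseteq> (\<Union>n. U n)"
        using CU(3,4) unfolding F_def by blast+
      ultimately show "\<exists>C' U'. closed C' \<and> open U' \<and> C' \<subseteq> (\<Union>n. A n) \<and> (\<Union>n. A n) \<subseteq> U' \<and> measure M (U' - C') < e"
        using clF CU(2) by (intro exI[of _ "F N"] exI[of _ "\<Union>n. U n"] conjI) auto
    qed
  qed
  then show ?thesis using assms(4) by (auto simp: P_def)
qed

section \<open>Invariant integration\<close>

text \<open>The metric of the type class stands for metrizability and need not be translation
  invariant. Connectedness is left to the lemmas that depend on it.\<close>

locale compact_haar =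
  fixes \<mu> :: "'g::{metric_space, topological_ab_group_add} measure"
  assumes haar: "haar_prob \<mu>" and compact_UNIV: "compact (UNIV :: 'g set)"

sublocale compact_haar \<subseteq> prob_space \<mu>
  using haar by (simp add: haar_prob_def)

sublocale compact_haar \<subseteq> pair_sigma_finite \<mu> \<mu> ..

context compact_haar
begin

lemma sets_haar [measurable_cong]: "sets \<mu> = sets borel"
  using haar by (simp add: haar_prob_def)

lemma space_haar [simp]: "space \<mu> = UNIV"
  using sets_eq_imp_space_eq[OF sets_haar] by simp

lemma distr_translate: "distr \<mu> borel ((+) a) = \<mu>"
  using haar by (simp add: haar_prob_def)

lemma plus_measurable [measurable (raw)]:
  assumes "u \<in> borel_measurable M" "v \<in> borel_measurable M"
  shows "(\<lambda>w. u w + v w :: 'g) \<in> borel_measurable M"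
proof -
  have "(\<lambda>p :: 'g \<times> 'g. fst p + snd p) \<in> borel_measurable (borel \<Otimes>\<^sub>M borel)"
    by (intro compact_metric_continuous_pair_measurable compact_UNIV continuous_intros)
  from measurable_compose[OF measurable_Pair[OF assms] this] show ?thesis by simp
qed

lemma uminus_measurable [measurable (raw)]:
  assumes "u \<in> borel_measurable M"
  shows "(\<lambda>w. - u w :: 'g) \<in> borel_measurable M"
  by (rule measurable_compose[OF assms borel_measurable_continuous_onI])
    (intro continuous_intros)

lemma minus_measurable [measurable (raw)]:
  assumes [measurable]: "u \<in> borel_measurable M" "v \<in> borel_measurable M"
  shows "(\<lambda>w. u w - v w :: 'g) \<in> borel_measurable M"
  unfolding diff_conv_add_uminus by measurable

lemma nn_integral_translate:
  assumes [measurable]: "k \<in> borel_measurable borel"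
  shows "(\<integral>\<^sup>+x. k (x + a) \<partial>\<mu>) = (\<integral>\<^sup>+x. k x \<partial>\<mu>)"
  by (subst (2) distr_translate[of a, symmetric], subst nn_integral_distr) (auto simp: add.commute)

text \<open>Integrate the indicator of A at x - y over both variables: doing x first gives the
  measure of A, doing y first gives that of its reflection. Fubini identifies the two.\<close>

lemma distr_reflect: "distr \<mu> borel uminus = \<mu>"
proof (rule measure_eqI)
  fix A :: "'g set" assume "A \<in> sets (distr \<mu> borel uminus)"
  then have A [measurable]: "A \<in> sets borel" by simp
  have "emeasure \<mu> A = (\<integral>\<^sup>+y. (\<integral>\<^sup>+x. indicator A (x + - y) \<partial>\<mu>) \<partial>\<mu>)"
    by (subst nn_integral_translate) (auto simp: emeasure_space_1[simplified] sets_haar)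
  also have "\<dots> = (\<integral>\<^sup>+x. (\<integral>\<^sup>+y. indicator A (x + - y) \<partial>\<mu>) \<partial>\<mu>)"
    by (rule Fubini') measurable
  also have "\<dots> = (\<integral>\<^sup>+x. (\<integral>\<^sup>+y. indicator A (- y) \<partial>\<mu>) \<partial>\<mu>)"
  proof (rule nn_integral_cong)
    fix x
    show "(\<integral>\<^sup>+y. indicator A (x + - y) \<partial>\<mu>) = (\<integral>\<^sup>+y. indicator A (- y) \<partial>\<mu>)"
      using nn_integral_translate[of "\<lambda>y. indicator A (x + - y)" x] by simp
  qed
  also have "\<dots> = (\<integral>\<^sup>+y. indicator A y \<partial>distr \<mu> borel uminus)"
    by (subst nn_integral_distr) (auto simp: emeasure_space_1[simplified])
  also have "\<dots> = emeasure (distr \<mu> borel uminus) A" by simp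
  finally show "emeasure (distr \<mu> borel uminus) A = emeasure \<mu> A" by simp
qed (simp add: sets_haar)

lemma integral_translate:
  fixes k :: "'g \<Rightarrow> real"
  assumes [measurable]: "k \<in> borel_measurable borel"
  shows "(\<integral>x. k (x + a) \<partial>\<mu>) = (\<integral>x. k x \<partial>\<mu>)"
  by (subst (2) distr_translate[of a, symmetric], subst integral_distr) (auto simp: add.commute)

lemma integrable_translate:
  fixes k :: "'g \<Rightarrow> real"
  assumes "integrable \<mu> k"
  shows "integrable \<mu> (\<lambda>x. k (x + a))"
proof -
  have [measurable]: "k \<in> borel_measurable borel"
    using borel_measurable_integrable[OF assms] by simp
  have "integrable (distr \<mu> borel ((+) a)) k" using assms by (simp add: distr_translate)
  then show ?thesis by (subst (asm) integrable_distr_eq) (auto simp: add.commute)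
qed

lemma integral_reflect:
  fixes k :: "'g \<Rightarrow> real"
  assumes [measurable]: "k \<in> borel_measurable borel"
  shows "(\<integral>y. k (x - y) \<partial>\<mu>) = (\<integral>y. k y \<partial>\<mu>)"
proof -
  have "(\<integral>y. k (x - y) \<partial>\<mu>) = (\<integral>y. k (x + y) \<partial>distr \<mu> borel uminus)"
    by (subst integral_distr) auto
  then show ?thesis using integral_translate[of k x] by (simp add: distr_reflect add.commute)
qed

lemma integrable_reflect:
  fixes k :: "'g \<Rightarrow> real"
  assumes "integrable \<mu> k"
  shows "integrable \<mu> (\<lambda>y. k (x - y))"
proof -
  have [measurable]: "k \<in> borel_measurable borel"
    using borel_measurable_integrable[OF assms] by simp
  have "integrable (distr \<mu> borel uminus) (\<lambda>y. k (y + x))"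
    using integrable_translate[OF assms] by (simp add: distr_reflect)
  then show ?thesis by (subst (asm) integrable_distr_eq) auto
qed

text \<open>Steinhaus' argument: squeeze H between a compact C and an open U of nearly the same
  measure. The v with C + v inside U form an open set V (tube lemma), and for such v the sets C and
  C + v overlap, so v is a difference of points of C and lies in H. Thus H contains a neighbourhood
  of 0, and both H and its complement are open.\<close>

lemma measurable_subgroup_eq_UNIV:
  assumes conn: "connected (UNIV :: 'g set)"
    and H: "H \<in> sets borel" "0 < measure \<mu> H"
    and diff: "\<And>x y. x \<in> H \<Longrightarrow> y \<in> H \<Longrightarrow> x - y \<in> H"
  shows "H = UNIV"
proof -
  have "\<exists>C U. closed C \<and> open U \<and> C \<subseteq> H \<and> H \<subseteq> U \<and> measure \<mu> (U - C) < measure \<mu> H / 2"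
    using H by (intro borel_closed_open_approx sets_haar) (auto intro: finite_measure_axioms)
  then obtain C U where CU: "closed C" "open U" "C \<subseteq> H" "H \<subseteq> U" "measure \<mu> (U - C) < measure \<mu> H / 2"
    by blast
  have [measurable]: "C \<in> sets borel" "U \<in> sets borel" using CU by auto
  \<comment> \<open>As U has at least the measure of H, this says that C fills more than half of U;
    two translates of C inside U must then meet.\<close>
  have mU: "measure \<mu> U - measure \<mu> C < measure \<mu> H / 2"
    using CU by (subst finite_measure_Diff[symmetric]) (auto simp: sets_haar)
  have mHU: "measure \<mu> H \<le> measure \<mu> U" using CU by (intro finite_measure_mono) (auto simp: sets_haar)
  define V where "V = {v. \<forall>x\<in>C. x + v \<in> U}"
  have opV: "open V"
  proof -
    have "compact C" using CU(1) compact_UNIV by (metis closed_Int_compact inf_top_right)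
    have op: "open ((\<lambda>p::'g\<times>'g. fst p + snd p) -` U)"
      using CU(2) by (intro open_vimage continuous_intros)
    show ?thesis
    proof (rule Topological_Spaces.openI)
      fix v assume "v \<in> V"
      then have "{v} \<times> C \<subseteq> (\<lambda>p. fst p + snd p) -` U"
        by (auto simp: V_def add.commute)
      then obtain T where "open T" "v \<in> T" "T \<times> C \<subseteq> (\<lambda>p. fst p + snd p) -` U"
        using Elementary_Topology.tube_lemma[OF \<open>compact C\<close> op] by blast
      then show "\<exists>T. open T \<and> v \<in> T \<and> T \<subseteq> V"
        by (intro exI[of _ T]) (force simp: V_def add.commute)
    qed
  qed
  have VH: "V \<subseteq> H"
  proof
    fix v assume v: "v \<in> V"
    define C' where "C' = (\<lambda>x. x + - v) -` C"
    have [measurable]: "C' \<in> sets borel"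
      unfolding C'_def by (intro borel_closed closed_vimage CU(1) continuous_intros)
    have "emeasure \<mu> C' = (\<integral>\<^sup>+x. indicator C' x \<partial>\<mu>)" by (simp add: sets_haar)
    also have "\<dots> = (\<integral>\<^sup>+x. indicator C (x + - v) \<partial>\<mu>)"
      by (intro nn_integral_cong) (auto simp: C'_def indicator_def)
    also have "\<dots> = emeasure \<mu> C" by (subst nn_integral_translate) (auto simp: sets_haar)
    finally have mC': "measure \<mu> C' = measure \<mu> C" by (simp add: measure_def)
    have C'U: "C' \<subseteq> U"
    proof
      fix x assume "x \<in> C'"
      then have "(x + - v) + v \<in> U" using v unfolding C'_def V_def by blast
      then show "x \<in> U" by simp
    qed
    have "C \<inter> C' \<noteq> {}"
    proof
      assume "C \<inter> C' = {}"
      then have "measure \<mu> C + measure \<mu> C' = measure \<mu> (C \<union> C')"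
        by (subst finite_measure_Union) (auto simp: sets_haar)
      also have "\<dots> \<le> measure \<mu> U" using C'U CU by (intro finite_measure_mono) (auto simp: sets_haar)
      finally show False using mC' mU mHU by linarith
    qed
    then obtain x where "x \<in> C" "x - v \<in> C" unfolding C'_def by auto
    then have "x - (x - v) \<in> H" using CU(3) diff by blast
    then show "v \<in> H" by simp
  qed
  have add: "x + y \<in> H" if "x \<in> H" "y \<in> H" for x y
    using diff[OF that(1) diff[OF diff[OF that(2) that(2)] that(2)]] by simp
  have "H \<noteq> {}" using H(2) by auto
  then obtain h where h: "h \<in> H" by auto
  have "0 \<in> V"
    using CU by (auto simp: V_def)
  have near: "open ((\<lambda>y. y - x) -` V)" for x
    using opV by (intro open_vimage continuous_intros)
  have "open H"
  proof (rule Topological_Spaces.openI)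
    fix x assume "x \<in> H"
    have "(\<lambda>y. y - x) -` V \<subseteq> H"
    proof
      fix y assume "y \<in> (\<lambda>y. y - x) -` V"
      then have "y - x \<in> H" using VH by auto
      then show "y \<in> H" using add[OF \<open>x \<in> H\<close>] by fastforce
    qed
    then show "\<exists>T. open T \<and> x \<in> T \<and> T \<subseteq> H" using near[of x] \<open>0 \<in> V\<close>
      by (intro exI[of _ "(\<lambda>y. y - x) -` V"]) auto
  qed
  moreover have "open (- H)"
  proof (rule Topological_Spaces.openI)
    fix x assume x: "x \<in> - H"
    have "(\<lambda>y. y - x) -` V \<subseteq> - H"
    proof
      fix y assume "y \<in> (\<lambda>y. y - x) -` V"
      then have "y - x \<in> H" using VH by auto
      then show "y \<in> - H" using x diff[of y "y - x"] by auto
    qed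
    then show "\<exists>T. open T \<and> x \<in> T \<and> T \<subseteq> - H" using near[of x] \<open>0 \<in> V\<close>
      by (intro exI[of _ "(\<lambda>y. y - x) -` V"]) auto
  qed
  ultimately show ?thesis
    using conn h unfolding connected_clopen closed_def by (auto simp: Compl_eq_Diff_UNIV)
qed

end

section \<open>The entropy function and convolution\<close>

text \<open>For a probability density the extra terms - u + 1 integrate to 0, so the integral is
  still that of u ln u, while the integrand becomes nonnegative. The value at 0 is 1.\<close>

definition ent_fun :: "real \<Rightarrow> real" where
  "ent_fun u = u * ln u - u + 1"

lemma ent_fun_measurable [measurable]: "ent_fun \<in> borel_measurable borel"
  unfolding ent_fun_def by measurable

text \<open>The left side is the tangent line of the convex function v ln v at the point
  \<open>exp l\<close>.\<close>

lemma mult_ln_ge_tangent: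
  assumes "0 \<le> (v::real)"
  shows "v * l + v - exp l \<le> v * ln v"
proof (cases "v = 0")
  case False
  then have v: "v > 0" using assms by simp
  have "ln (exp l / v) \<le> exp l / v - 1" using v by (intro ln_le_minus_one) auto
  then have "l - ln v \<le> exp l / v - 1" using v by (simp add: ln_div)
  then have "v * (l - ln v) \<le> v * (exp l / v - 1)" using v by (intro mult_left_mono) auto
  then show ?thesis using v by (simp add: algebra_simps)
qed simp

lemma ent_fun_nonneg: "0 \<le> u \<Longrightarrow> 0 \<le> ent_fun u"
  using mult_ln_ge_tangent[of u 0] by (simp add: ent_fun_def)

text \<open>Compare both sides with 1/(1 + l), using (1 - l + l^2)(1 + l) = 1 + l^3.\<close>

lemma exp_minus_le_quadratic:
  assumes "0 \<le> (l::real)"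
  shows "exp (- l) \<le> 1 - l + l\<^sup>2"
proof -
  have "exp (- l) \<le> 1 / (1 + l)"
    using exp_ge_add_one_self[of l] assms by (simp add: exp_minus divide_simps)
  also have "\<dots> \<le> 1 - l + l\<^sup>2"
  proof -
    have "1 \<le> (1 - l + l\<^sup>2) * (1 + l)"
      using assms by (simp add: algebra_simps power2_eq_square)
    then show ?thesis using assms by (simp add: divide_simps mult.commute)
  qed
  finally show ?thesis .
qed

text \<open>A linearized pointwise Pinsker inequality: use the tangent at \<open>exp l\<close> for v
  >= 1 and at \<open>exp (- l)\<close> for v < 1.\<close>

lemma ent_fun_ge_abs:
  assumes "0 \<le> v" "0 \<le> l" "l \<le> 1"
  shows "l * \<bar>v - 1\<bar> - l\<^sup>2 \<le> ent_fun v"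
proof (cases "1 \<le> v")
  case True
  have "exp l \<le> 1 + l + l\<^sup>2" using exp_bound assms by simp
  then show ?thesis
    using True mult_ln_ge_tangent[OF assms(1), of l] unfolding ent_fun_def
    by (simp add: algebra_simps)
next
  case False
  then show ?thesis
    using exp_minus_le_quadratic[OF assms(2)] mult_ln_ge_tangent[OF assms(1), of "- l"] unfolding ent_fun_def
    by (simp add: algebra_simps)
qed

text \<open>Rescaling of \<open>ent_fun_ge_abs\<close>: apply it to u / c and multiply by c. The
  case c = u = 0 covers points where the convolution vanishes; it relies on
  \<open>ln 0 = 0\<close>.\<close>

lemma ent_fun_ge_tangent:
  assumes "0 \<le> u" "0 < c \<or> c = 0 \<and> u = 0" "0 \<le> l" "l \<le> 1"
  shows "u * ln c + (1 - c - l\<^sup>2 * c) + l * \<bar>u - c\<bar> \<le> ent_fun u"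
proof (cases "c = 0")
  case True
  then show ?thesis using assms(2) by (simp add: ent_fun_def)
next
  case False
  then have c: "c > 0" using assms by auto
  have "l * \<bar>u / c - 1\<bar> - l\<^sup>2 \<le> ent_fun (u / c)"
    using assms c by (intro ent_fun_ge_abs) auto
  then have "c * (l * \<bar>u / c - 1\<bar> - l\<^sup>2) \<le> c * ent_fun (u / c)"
    using c by (intro mult_left_mono) auto
  moreover have "c * \<bar>u / c - 1\<bar> = \<bar>u - c\<bar>"
    using c by (simp add: abs_if field_simps)
  then have "c * (l * \<bar>u / c - 1\<bar> - l\<^sup>2) = l * \<bar>u - c\<bar> - l\<^sup>2 * c"
    by (simp add: right_diff_distrib mult.left_commute mult.commute)
  moreover have "c * ent_fun (u / c) = u * ln u - u * ln c - u + c"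
  proof (cases "u = 0")
    case False
    then show ?thesis using c assms(1) by (simp add: ent_fun_def ln_div algebra_simps)
  qed (simp add: ent_fun_def)
  ultimately show ?thesis by (simp add: ent_fun_def)
qed

section \<open>Convolution and its effect on relative entropy\<close>

context compact_haar
begin

text \<open>Where the integrand is not integrable the value is 0 by default; for integrable
  arguments \<open>AE_integrable_conv\<close> confines this to a null set.\<close>

definition conv :: "('g \<Rightarrow> real) \<Rightarrow> ('g \<Rightarrow> real) \<Rightarrow> 'g \<Rightarrow> real" where
  "conv w k x = (\<integral>y. w y * k (x - y) \<partial>\<mu>)"

lemma integrable_haar_measurable:
  fixes k :: "'g \<Rightarrow> real"
  shows "integrable \<mu> k \<Longrightarrow> k \<in> borel_measurable borel"
  using borel_measurable_integrable[of \<mu> k] by (simp cong: measurable_cong_sets add: sets_haar)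

lemma conv_commute:
  assumes [measurable]: "w \<in> borel_measurable borel" "k \<in> borel_measurable borel"
  shows "conv w k x = conv k w x"
  unfolding conv_def using integral_reflect[of "\<lambda>y. w y * k (x - y)" x] by (simp add: mult.commute)

lemma conv_measurable [measurable]:
  assumes [measurable]: "w \<in> borel_measurable borel" "k \<in> borel_measurable borel"
  shows "conv w k \<in> borel_measurable borel"
  unfolding conv_def by measurable

lemma integrable_pair_conv:
  fixes w k :: "'g \<Rightarrow> real"
  assumes w: "integrable \<mu> w" and k: "integrable \<mu> k"
  shows "integrable (\<mu> \<Otimes>\<^sub>M \<mu>) (\<lambda>(y, x). w y * k (x - y))"
proof (rule Fubini_integrable)
  note [measurable] = integrable_haar_measurable[OF w] integrable_haar_measurable[OF k]
  show "(\<lambda>(y, x). w y * k (x - y)) \<in> borel_measurable (\<mu> \<Otimes>\<^sub>M \<mu>)" by measurable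
  have "(\<integral>x. norm (w y * k (x - y)) \<partial>\<mu>) = \<bar>w y\<bar> * (\<integral>x. \<bar>k x\<bar> \<partial>\<mu>)" for y
    using integral_translate[of "\<lambda>x. \<bar>k x\<bar>" "- y"] by (simp add: abs_mult)
  then show "integrable \<mu> (\<lambda>y. \<integral>x. norm (case (y, x) of (y, x) \<Rightarrow> w y * k (x - y)) \<partial>\<mu>)"
    using w by simp
  show "AE y in \<mu>. integrable \<mu> (\<lambda>x. case (y, x) of (y, x) \<Rightarrow> w y * k (x - y))"
    using integrable_translate[OF k, of "- y" for y] by auto
qed

lemma AE_integrable_conv:
  fixes w k :: "'g \<Rightarrow> real"
  assumes "integrable \<mu> w" "integrable \<mu> k"
  shows "AE x in \<mu>. integrable \<mu> (\<lambda>y. w y * k (x - y))"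
  using AE_integrable_snd[OF integrable_pair_conv[OF assms]] .

lemma integrable_conv:
  fixes w k :: "'g \<Rightarrow> real"
  assumes "integrable \<mu> w" "integrable \<mu> k"
  shows "integrable \<mu> (conv w k)"
  unfolding conv_def using integrable_snd[OF integrable_pair_conv[OF assms]] by simp

lemma integral_conv:
  fixes w k :: "'g \<Rightarrow> real"
  assumes "integrable \<mu> w" "integrable \<mu> k"
  shows "(\<integral>x. conv w k x \<partial>\<mu>) = (\<integral>x. w x \<partial>\<mu>) * (\<integral>x. k x \<partial>\<mu>)"
proof -
  have "(\<integral>x. conv w k x \<partial>\<mu>) = (\<integral>y. (\<integral>x. w y * k (x - y) \<partial>\<mu>) \<partial>\<mu>)"
    unfolding conv_def by (rule Fubini_integral[OF integrable_pair_conv[OF assms]])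
  also have "\<dots> = (\<integral>y. w y * (\<integral>x. k x \<partial>\<mu>) \<partial>\<mu>)"
  proof (rule Bochner_Integration.integral_cong)
    show "(\<integral>x. w y * k (x - y) \<partial>\<mu>) = w y * (\<integral>x. k x \<partial>\<mu>)" for y
      using integral_translate[OF integrable_haar_measurable[OF assms(2)], of "- y"] by simp
  qed simp
  finally show ?thesis by simp
qed

lemma conv_nonneg: "(\<And>y. 0 \<le> w y) \<Longrightarrow> (\<And>y. 0 \<le> k y) \<Longrightarrow> 0 \<le> conv w k x"
  by (simp add: conv_def)

definition finite_entropy_density :: "('g \<Rightarrow> real) \<Rightarrow> bool" where
  "finite_entropy_density f \<longleftrightarrow> (\<forall>x. 0 \<le> f x) \<and> integrable \<mu> f \<and> (\<integral>x. f x \<partial>\<mu>) = 1 \<and>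
     integrable \<mu> (\<lambda>x. ent_fun (f x))"

definition rel_entropy :: "('g \<Rightarrow> real) \<Rightarrow> real" where
  "rel_entropy f = (\<integral>x. ent_fun (f x) \<partial>\<mu>)"

text \<open>Its average against g is the L1 quantity that the entropy drop from f to
  \<open>conv g f\<close> controls.\<close>

definition conv_deviation :: "('g \<Rightarrow> real) \<Rightarrow> ('g \<Rightarrow> real) \<Rightarrow> 'g \<Rightarrow> real" where
  "conv_deviation g f y = (\<integral>x. \<bar>f (x - y) - conv g f x\<bar> \<partial>\<mu>)"

lemma finite_entropy_densityD:
  assumes "finite_entropy_density f"
  shows "0 \<le> f x" "integrable \<mu> f" "(\<integral>x. f x \<partial>\<mu>) = 1" "integrable \<mu> (\<lambda>x. ent_fun (f x))"
    "f \<in> borel_measurable borel"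
  using assms integrable_haar_measurable unfolding finite_entropy_density_def by auto

text \<open>This is \<open>ent_fun_ge_tangent\<close> at u = f(x - y), integrated in y against w
  with x fixed. The weight may have any total mass, because it is applied both to a density and to
  the excess of one. If c = 0, the vanishing of the convolution forces w(y) f(x - y) = 0 for almost
  every y.\<close>

lemma conv_pointwise_tangent:
  assumes f: "\<And>x. 0 \<le> f x" and w: "\<And>x. 0 \<le> w x" and l: "0 \<le> l" "l \<le> 1"
    and int: "integrable \<mu> w" "integrable \<mu> (\<lambda>y. w y * f (x - y))"
      "integrable \<mu> (\<lambda>y. w y * ent_fun (f (x - y)))" "integrable \<mu> (\<lambda>y. w y * \<bar>f (x - y) - c\<bar>)"
    and c: "0 < c \<or> c = 0 \<and> conv w f x = 0"
  shows "conv w f x * ln c + (\<integral>y. w y \<partial>\<mu>) * (1 - c - l\<^sup>2 * c) + l * (\<integral>y. w y * \<bar>f (x - y) - c\<bar> \<partial>\<mu>)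
    \<le> (\<integral>y. w y * ent_fun (f (x - y)) \<partial>\<mu>)"
proof -
  have ae: "AE y in \<mu>. 0 < c \<or> c = 0 \<and> (w y = 0 \<or> f (x - y) = 0)"
  proof (cases "c = 0")
    case True
    then have "(\<integral>y. w y * f (x - y) \<partial>\<mu>) = 0" using c by (simp add: conv_def)
    then have "AE y in \<mu>. w y * f (x - y) = 0"
      using integral_nonneg_eq_0_iff_AE[OF int(2)] f w by simp
    then show ?thesis using True by simp
  qed (use c in auto)
  have "conv w f x * ln c + (\<integral>y. w y \<partial>\<mu>) * (1 - c - l\<^sup>2 * c) + l * (\<integral>y. w y * \<bar>f (x - y) - c\<bar> \<partial>\<mu>)
    = (\<integral>y. w y * f (x - y) * ln c + w y * (1 - c - l\<^sup>2 * c) + l * (w y * \<bar>f (x - y) - c\<bar>) \<partial>\<mu>)"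
    using int by (simp add: conv_def)
  also have "\<dots> \<le> (\<integral>y. w y * ent_fun (f (x - y)) \<partial>\<mu>)"
  proof (rule integral_mono_AE)
    show "integrable \<mu> (\<lambda>y. w y * f (x - y) * ln c + w y * (1 - c - l\<^sup>2 * c) + l * (w y * \<bar>f (x - y) - c\<bar>))"
      using int by simp
    show "AE y in \<mu>. w y * f (x - y) * ln c + w y * (1 - c - l\<^sup>2 * c) + l * (w y * \<bar>f (x - y) - c\<bar>)
        \<le> w y * ent_fun (f (x - y))"
      using ae
    proof eventually_elim
      case (elim y)
      show ?case
      proof (cases "w y = 0")
        case False
        have "w y * (f (x - y) * ln c + (1 - c - l\<^sup>2 * c) + l * \<bar>f (x - y) - c\<bar>) \<le> w y * ent_fun (f (x - y))"
          using elim False w f l by (intro mult_left_mono ent_fun_ge_tangent) auto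
        then show ?thesis by (simp add: algebra_simps)
      qed simp
    qed
  qed (fact int(3))
  finally show ?thesis .
qed

text \<open>Take the tangent point c = r x in \<open>conv_pointwise_tangent\<close> and integrate
  over x; the error l^2 r x integrates to l^2. The three conclusions share this pointwise bound.
  With l = 0 it is Jensen's inequality and says that convolution does not increase relative
  entropy.\<close>

lemma
  assumes g: "finite_entropy_density g" and f: "finite_entropy_density f"
  shows finite_entropy_density_conv: "finite_entropy_density (conv g f)"
    and rel_entropy_conv: "0 \<le> l \<Longrightarrow> l \<le> 1 \<Longrightarrow>
      rel_entropy (conv g f) + l * (\<integral>y. g y * conv_deviation g f y \<partial>\<mu>) \<le> rel_entropy f + l\<^sup>2"
    and integrable_conv_deviation: "integrable \<mu> (\<lambda>y. g y * conv_deviation g f y)"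
proof -
  note F = finite_entropy_densityD[OF f] and G = finite_entropy_densityD[OF g]
  note [measurable] = F(5) G(5)
  define r where "r = conv g f"
  have r: "0 \<le> r x" for x unfolding r_def by (intro conv_nonneg F G)
  have [measurable]: "r \<in> borel_measurable borel" unfolding r_def by measurable
  have ir: "integrable \<mu> r" and r1: "(\<integral>x. r x \<partial>\<mu>) = 1"
    unfolding r_def using integrable_conv integral_conv F G by auto
  have pair_r: "integrable (\<mu> \<Otimes>\<^sub>M \<mu>) (\<lambda>(y, x). g y * r x)"
    by (rule Fubini_integrable) (use G ir in \<open>auto simp: abs_mult\<close>)
  have pair: "integrable (\<mu> \<Otimes>\<^sub>M \<mu>) (\<lambda>(y, x). g y * \<bar>f (x - y) - r x\<bar>)"
  proof (rule Bochner_Integration.integrable_bound)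
    show "integrable (\<mu> \<Otimes>\<^sub>M \<mu>) (\<lambda>p. (case p of (y, x) \<Rightarrow> g y * f (x - y)) + (case p of (y, x) \<Rightarrow> g y * r x))"
      by (intro Bochner_Integration.integrable_add integrable_pair_conv pair_r F G)
    show "AE p in \<mu> \<Otimes>\<^sub>M \<mu>. norm (case p of (y, x) \<Rightarrow> g y * \<bar>f (x - y) - r x\<bar>)
      \<le> norm ((case p of (y, x) \<Rightarrow> g y * f (x - y)) + (case p of (y, x) \<Rightarrow> g y * r x))"
    proof (rule AE_I2, clarify)
      fix y x
      have "g y * \<bar>f (x - y) - r x\<bar> \<le> g y * (f (x - y) + r x)"
        using F(1)[of "x - y"] G(1) r[of x] by (intro mult_left_mono) auto
      then show "norm (g y * \<bar>f (x - y) - r x\<bar>) \<le> norm (g y * f (x - y) + g y * r x)"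
        using F(1)[of "x - y"] G(1)[of y] r[of x] by (simp add: distrib_left)
    qed
  qed measurable
  have dev: "conv_deviation g f y = (\<integral>x. \<bar>f (x - y) - r x\<bar> \<partial>\<mu>)" for y
    by (simp add: conv_deviation_def r_def)
  have int_dev: "integrable \<mu> (\<lambda>y. g y * conv_deviation g f y)"
    using integrable_fst[OF pair] by (simp add: dev)
  then show "integrable \<mu> (\<lambda>y. g y * conv_deviation g f y)" .
  have main: "AE x in \<mu>. ent_fun (r x) - l\<^sup>2 * r x + l * (\<integral>y. g y * \<bar>f (x - y) - r x\<bar> \<partial>\<mu>)
      \<le> conv g (\<lambda>u. ent_fun (f u)) x" if l: "0 \<le> l" "l \<le> 1" for l
    using AE_integrable_conv[OF G(2) F(2)] AE_integrable_conv[OF G(2) F(4)] AE_integrable_snd[OF pair]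
  proof eventually_elim
    case (elim x)
    have "conv g f x * ln (r x) + (\<integral>y. g y \<partial>\<mu>) * (1 - r x - l\<^sup>2 * r x) + l * (\<integral>y. g y * \<bar>f (x - y) - r x\<bar> \<partial>\<mu>)
      \<le> (\<integral>y. g y * ent_fun (f (x - y)) \<partial>\<mu>)"
      using elim F(1) G(1,2) l r[of x] by (intro conv_pointwise_tangent) (auto simp: r_def)
    then show ?case by (simp add: conv_def[of g "\<lambda>u. ent_fun (f u)"] r_def[symmetric] ent_fun_def[of "r x"] G(3))
  qed
  have int_ent: "integrable \<mu> (\<lambda>x. ent_fun (r x))"
  proof (rule Bochner_Integration.integrable_bound)
    show "integrable \<mu> (conv g (\<lambda>u. ent_fun (f u)))" by (intro integrable_conv F G)
    show "AE x in \<mu>. norm (ent_fun (r x)) \<le> norm (conv g (\<lambda>u. ent_fun (f u)) x)"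
      using main[of 0] by (rule AE_mp) (auto simp: ent_fun_nonneg r)
  qed measurable
  show "finite_entropy_density (conv g f)"
    using r ir r1 int_ent unfolding finite_entropy_density_def r_def by auto
  show "rel_entropy (conv g f) + l * (\<integral>y. g y * conv_deviation g f y \<partial>\<mu>) \<le> rel_entropy f + l\<^sup>2"
    if l: "0 \<le> l" "l \<le> 1"
  proof -
    have swap: "(\<integral>y. g y * conv_deviation g f y \<partial>\<mu>) = (\<integral>x. (\<integral>y. g y * \<bar>f (x - y) - r x\<bar> \<partial>\<mu>) \<partial>\<mu>)"
      using Fubini_integral[OF pair] by (simp add: dev)
    have i2: "integrable \<mu> (\<lambda>x. \<integral>y. g y * \<bar>f (x - y) - r x\<bar> \<partial>\<mu>)"
      using integrable_snd[OF pair] by simp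
    have "rel_entropy (conv g f) - l\<^sup>2 + l * (\<integral>y. g y * conv_deviation g f y \<partial>\<mu>)
      = (\<integral>x. ent_fun (r x) - l\<^sup>2 * r x + l * (\<integral>y. g y * \<bar>f (x - y) - r x\<bar> \<partial>\<mu>) \<partial>\<mu>)"
      using int_ent ir i2 r1 by (simp add: swap rel_entropy_def r_def[symmetric])
    also have "\<dots> \<le> (\<integral>x. conv g (\<lambda>u. ent_fun (f u)) x \<partial>\<mu>)"
      using int_ent ir i2 main[OF l] by (intro integral_mono_AE integrable_conv F G) auto
    also have "\<dots> = rel_entropy f"
      by (subst integral_conv) (simp_all add: F G rel_entropy_def)
    finally show ?thesis by simp
  qed
qed

text \<open>Split f into its excess q over 1, of mass p, and m = min f 1, and split r ln r
  accordingly. The part from q is handled by convexity and costs p times the relative entropy of g;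
  the part from m is harmless because its convolution with g is at most 1. No entropy of f enters
  the bound.\<close>

lemma rel_entropy_conv_le:
  assumes g: "finite_entropy_density g" and f: "finite_entropy_density f"
  shows "rel_entropy (conv g f) \<le> (\<integral>x. max (f x - 1) 0 \<partial>\<mu>) * (1 + rel_entropy g)"
proof -
  note F = finite_entropy_densityD[OF f] and G = finite_entropy_densityD[OF g]
  note [measurable] = F(5) G(5)
  define r where "r = conv g f"
  define q where "q x = max (f x - 1) 0" for x
  define m where "m x = min (f x) 1" for x
  define p where "p = (\<integral>x. q x \<partial>\<mu>)"
  have r: "0 \<le> r x" for x unfolding r_def by (intro conv_nonneg F G)
  have ir: "integrable \<mu> r" and r1: "(\<integral>x. r x \<partial>\<mu>) = 1"
    unfolding r_def using integrable_conv integral_conv F G by auto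
  have q: "0 \<le> q x" "integrable \<mu> q" for x
    unfolding q_def by (auto intro!: integrable_max F)
  have m: "0 \<le> m x" "m x \<le> 1" "integrable \<mu> m" for x
    unfolding m_def by (auto intro!: integrable_min F)
  note [measurable] = integrable_haar_measurable[OF q(2)] integrable_haar_measurable[OF m(3)]
  have fqm: "f x = q x + m x" for x by (auto simp: q_def m_def)
  have pm: "(\<integral>x. m x \<partial>\<mu>) = 1 - p"
    using F(3) unfolding fqm p_def using q m by simp
  have "AE x in \<mu>. ent_fun (r x) + conv g m x \<le> conv q (\<lambda>u. ent_fun (g u)) x + p * (r x - 1) + 1"
    using AE_integrable_conv[OF q(2) G(2)] AE_integrable_conv[OF q(2) G(4)] AE_integrable_conv[OF G(2) m(3)]
  proof eventually_elim
    case (elim x)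
    have c1: "r x = conv q g x + conv g m x"
    proof -
      have "integrable \<mu> (\<lambda>y. g y * q (x - y))"
        using integrable_reflect[OF elim(1), of x] by (simp add: mult.commute)
      then have "conv g f x = conv g q x + conv g m x"
        using elim(3) by (simp add: conv_def fqm distrib_left)
      then show ?thesis by (simp add: r_def conv_commute)
    qed
    have A0: "0 \<le> conv g m x" by (intro conv_nonneg G m)
    have A1: "conv g m x \<le> 1"
    proof -
      have "conv g m x \<le> (\<integral>y. g y \<partial>\<mu>)"
        unfolding conv_def
        by (intro integral_mono elim G mult_right_le_one_le) (use m G in auto)
      then show ?thesis using G(3) by simp
    qed
    have B0: "0 \<le> conv q g x" by (intro conv_nonneg G q)
    \<comment> \<open>With a = \<open>conv g m x\<close>, the tangent at r gives a ln r <= a ln a +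
      r - a, and a ln a <= 0 since a <= 1.\<close>
    have Alnr: "conv g m x * ln (r x) \<le> r x - conv g m x"
    proof (cases "conv g m x = 0")
      case False
      then have a: "0 < conv g m x" using A0 by simp
      have "0 < r x" using a B0 c1 by simp
      from mult_ln_ge_tangent[OF A0, of "ln (r x)"] this
      have "conv g m x * ln (r x) + conv g m x - r x \<le> conv g m x * ln (conv g m x)" by simp
      moreover have "conv g m x * ln (conv g m x) \<le> 0"
        using A0 A1 a by (intro mult_nonneg_nonpos) auto
      ultimately show ?thesis by simp
    qed (use r in simp)
    have "integrable \<mu> (\<lambda>y. q y * g (x - y) + r x * q y)"
      using elim q by simp
    then have id: "integrable \<mu> (\<lambda>y. q y * \<bar>g (x - y) - r x\<bar>)"
    proof (rule Bochner_Integration.integrable_bound)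
      have "q y * \<bar>g (x - y) - r x\<bar> \<le> q y * (g (x - y) + r x)" for y
        using G(1)[of "x - y"] q(1) r[of x] by (intro mult_left_mono) auto
      then show "AE y in \<mu>. norm (q y * \<bar>g (x - y) - r x\<bar>) \<le> norm (q y * g (x - y) + r x * q y)"
        using G(1) q(1) r by (intro AE_I2) (simp add: distrib_left mult.commute)
    qed measurable
    \<comment> \<open>Here q is the weight, g is the translated function, and the tangent point is
      the full r x rather than the value of \<open>conv q g\<close>. The choice l = 0 suppresses the
      L1 term.\<close>
    have "conv q g x * ln (r x) + (\<integral>y. q y \<partial>\<mu>) * (1 - r x - 0\<^sup>2 * r x) + 0 * (\<integral>y. q y * \<bar>g (x - y) - r x\<bar> \<partial>\<mu>)
      \<le> (\<integral>y. q y * ent_fun (g (x - y)) \<partial>\<mu>)"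
      using elim q G(1) id r[of x] c1 A0 B0 by (intro conv_pointwise_tangent) auto
    then have "conv q g x * ln (r x) + p * (1 - r x) \<le> conv q (\<lambda>u. ent_fun (g u)) x"
      by (simp add: p_def conv_def)
    moreover have "ent_fun (r x) = conv q g x * ln (r x) + conv g m x * ln (r x) - r x + 1"
      unfolding ent_fun_def by (subst (1) c1) (simp add: distrib_right)
    ultimately show ?case using Alnr by (simp add: algebra_simps)
  qed
  moreover have "integrable \<mu> (\<lambda>x. ent_fun (r x))"
    using finite_entropy_densityD(4)[OF finite_entropy_density_conv[OF g f]] by (simp add: r_def)
  ultimately have "(\<integral>x. ent_fun (r x) + conv g m x \<partial>\<mu>)
      \<le> (\<integral>x. conv q (\<lambda>u. ent_fun (g u)) x + p * (r x - 1) + 1 \<partial>\<mu>)"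
    using ir by (intro integral_mono_AE Bochner_Integration.integrable_add integrable_mult_right
      Bochner_Integration.integrable_diff integrable_const integrable_conv q G m)
  also have "\<dots> = p * rel_entropy g + 1"
    using ir r1 prob_space
    by (simp add: integrable_conv q G integral_conv p_def[symmetric] rel_entropy_def)
  also have "(\<integral>x. ent_fun (r x) + conv g m x \<partial>\<mu>) = rel_entropy r + (1 - p)"
    using \<open>integrable \<mu> (\<lambda>x. ent_fun (r x))\<close>
    by (simp add: integrable_conv m G integral_conv pm rel_entropy_def)
  finally show ?thesis by (simp add: r_def p_def q_def distrib_left)
qed

end

section \<open>Almost invariant densities\<close>

context compact_haar
begin

definition translation_dist :: "('g \<Rightarrow> real) \<Rightarrow> 'g \<Rightarrow> real" where
  "translation_dist f z = (\<integral>x. \<bar>f (x - z) - f x\<bar> \<partial>\<mu>)"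

lemma translation_dist_measurable [measurable]:
  assumes [measurable]: "f \<in> borel_measurable borel"
  shows "translation_dist f \<in> borel_measurable borel"
  unfolding translation_dist_def by measurable

lemma integrable_shift:
  fixes f :: "'g \<Rightarrow> real"
  assumes "integrable \<mu> f"
  shows "integrable \<mu> (\<lambda>x. f (x - a))"
  using integrable_translate[OF assms, of "- a"] by simp

text \<open>Triangle inequality after a translation by w. The midpoint r is the convolution when
  both translates are known to be near it, and f itself in the proof of closure under
  differences.\<close>

lemma translation_dist_diff_le:
  assumes f: "integrable \<mu> f" and r: "integrable \<mu> r"
  shows "translation_dist f (z - w) \<le> (\<integral>x. \<bar>f (x - z) - r x\<bar> \<partial>\<mu>) + (\<integral>x. \<bar>f (x - w) - r x\<bar> \<partial>\<mu>)"
proof -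
  note [measurable] = integrable_haar_measurable[OF f] integrable_haar_measurable[OF r]
  note fi = integrable_shift[OF f]
  have "translation_dist f (z - w) = (\<integral>x. \<bar>f (x - z) - f (x - w)\<bar> \<partial>\<mu>)"
    using integral_translate[of "\<lambda>x. \<bar>f (x - (z - w)) - f x\<bar>" "- w"]
    by (simp add: translation_dist_def algebra_simps)
  also have "\<dots> \<le> (\<integral>x. \<bar>f (x - z) - r x\<bar> + \<bar>f (x - w) - r x\<bar> \<partial>\<mu>)"
    using fi r by (intro integral_mono) auto
  also have "\<dots> = (\<integral>x. \<bar>f (x - z) - r x\<bar> \<partial>\<mu>) + (\<integral>x. \<bar>f (x - w) - r x\<bar> \<partial>\<mu>)"
    using fi r by (intro Bochner_Integration.integral_add) auto
  finally show ?thesis .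
qed

text \<open>The set T - z has g-mass at least that of T minus 1/2, hence more than 1/4. Were it
  disjoint from T, the total mass would exceed 1.\<close>

lemma large_mass_translate_meets:
  assumes g: "\<And>x. 0 \<le> g x" "integrable \<mu> g" "(\<integral>x. g x \<partial>\<mu>) = 1"
    and T: "T \<in> sets borel" "3 / 4 < (\<integral>y. g y * indicator T y \<partial>\<mu>)"
    and z: "translation_dist g z \<le> 1 / 2"
  shows "\<exists>y. y \<in> T \<and> y + z \<in> T"
proof (rule ccontr)
  assume no: "\<not> ?thesis"
  note [measurable] = integrable_haar_measurable[OF g(2)] T(1)
  note gi = integrable_shift[OF g(2), of z]
  have bounded: "integrable \<mu> (\<lambda>y. k y * indicator S y)"
    if [measurable]: "S \<in> sets borel" and "integrable \<mu> k" for S and k :: "'g \<Rightarrow> real"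
    using that(2) by (rule Bochner_Integration.integrable_bound)
      (use integrable_haar_measurable[OF that(2)] in \<open>auto simp: indicator_def\<close>)
  define S where "S = (\<lambda>y. y + z) -` T"
  have S [measurable]: "S \<in> sets borel"
    using measurable_sets[of "\<lambda>y::'g. y + z" borel borel T] by (simp add: S_def)
  have "(\<integral>y. g y * indicator T y \<partial>\<mu>) - translation_dist g z
      = (\<integral>y. g y * indicator T y - \<bar>g (y - z) - g y\<bar> \<partial>\<mu>)"
    unfolding translation_dist_def
    using bounded[OF T(1) g(2)] g(2) gi by (subst Bochner_Integration.integral_diff) auto
  also have "\<dots> \<le> (\<integral>y. g (y - z) * indicator T y \<partial>\<mu>)"
    using bounded[OF T(1) g(2)] bounded[OF T(1) gi] g gi by (intro integral_mono) (auto simp: indicator_def)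
  also have "\<dots> = (\<integral>y. g y * indicator S y \<partial>\<mu>)"
  proof -
    have "(\<integral>y. g y * indicator S y \<partial>\<mu>) = (\<integral>y. g ((y + z) - z) * indicator T (y + z) \<partial>\<mu>)"
      by (intro Bochner_Integration.integral_cong) (auto simp: S_def indicator_def)
    then show ?thesis using integral_translate[of "\<lambda>y. g (y - z) * indicator T y" z] by simp
  qed
  finally have "(\<integral>y. g y * indicator T y \<partial>\<mu>) - translation_dist g z \<le> (\<integral>y. g y * indicator S y \<partial>\<mu>)" .
  moreover have "(\<integral>y. g y * indicator T y \<partial>\<mu>) + (\<integral>y. g y * indicator S y \<partial>\<mu>)
      = (\<integral>y. g y * indicator T y + g y * indicator S y \<partial>\<mu>)"
    using bounded[OF _ g(2)] T(1) S by simp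
  moreover have "\<dots> \<le> (\<integral>y. g y \<partial>\<mu>)"
  proof (rule integral_mono)
    show "integrable \<mu> (\<lambda>y. g y * indicator T y + g y * indicator S y)"
      by (intro Bochner_Integration.integrable_add bounded T(1) S g(2))
    show "g y * indicator T y + g y * indicator S y \<le> g y" for y
      using no g(1)[of y] by (auto simp: indicator_def S_def)
  qed (fact g(2))
  ultimately show False using T(2) z g(3) by linarith
qed

lemma conv_deviation_measurable [measurable]:
  assumes [measurable]: "g \<in> borel_measurable borel" "f \<in> borel_measurable borel"
  shows "conv_deviation g f \<in> borel_measurable borel"
  unfolding conv_deviation_def by measurable

lemma conv_deviation_nonneg: "0 \<le> conv_deviation g f y"
  by (simp add: conv_deviation_def)

text \<open>Markov's inequality: the exceptional set has g-mass at most (2/s)(s/32) = 1/16.\<close>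

lemma small_deviation_large_mass:
  assumes g: "finite_entropy_density g" and f: "finite_entropy_density f"
    and s: "0 < s" "(\<integral>y. g y * conv_deviation g f y \<partial>\<mu>) \<le> s / 32"
  shows "3 / 4 < (\<integral>y. g y * indicator {y. conv_deviation g f y \<le> s / 2} y \<partial>\<mu>)"
proof -
  note F = finite_entropy_densityD[OF f] and G = finite_entropy_densityD[OF g]
  note [measurable] = F(5) G(5)
  define T where "T = {y. conv_deviation g f y \<le> s / 2}"
  have [measurable]: "T \<in> sets borel" unfolding T_def by measurable
  have iT: "integrable \<mu> (\<lambda>y. g y * indicator T y)"
    by (rule Bochner_Integration.integrable_bound[OF G(2)]) (auto simp: indicator_def)
  have dev: "integrable \<mu> (\<lambda>y. g y * conv_deviation g f y)"
    by (rule integrable_conv_deviation[OF g f])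
  have "1 - (\<integral>y. g y * indicator T y \<partial>\<mu>) = (\<integral>y. g y - g y * indicator T y \<partial>\<mu>)"
    using G iT by simp
  also have "\<dots> \<le> (\<integral>y. 2 / s * (g y * conv_deviation g f y) \<partial>\<mu>)"
  proof (rule integral_mono)
    fix y
    show "g y - g y * indicator T y \<le> 2 / s * (g y * conv_deviation g f y)"
    proof (cases "y \<in> T")
      case True
      then show ?thesis using G(1) conv_deviation_nonneg s(1) by simp
    next
      case False
      then have "g y * 1 \<le> g y * (2 / s * conv_deviation g f y)"
        using s(1) G(1) by (intro mult_left_mono) (auto simp: T_def field_simps)
      then show ?thesis using False by (simp add: mult_ac)
    qed
  qed (use G(2) iT dev in auto)
  also have "\<dots> = 2 / s * (\<integral>y. g y * conv_deviation g f y \<partial>\<mu>)" by simp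
  also have "\<dots> \<le> 2 / s * (s / 32)" using s by (intro mult_left_mono) auto
  also have "\<dots> = 1 / 16" using s by simp
  finally show ?thesis by (simp add: T_def)
qed

text \<open>Some y and y + z both lie in the set of small deviation, so the translates of f by y and
  by y + z are each within s/2 of the same function \<open>conv g f\<close>.\<close>

lemma small_translation_dist_improves:
  assumes g: "finite_entropy_density g" and f: "finite_entropy_density f"
    and s: "0 < s" "(\<integral>y. g y * conv_deviation g f y \<partial>\<mu>) \<le> s / 32"
    and z: "translation_dist g z \<le> 1 / 2"
  shows "translation_dist f z \<le> s"
proof -
  note F = finite_entropy_densityD[OF f] and G = finite_entropy_densityD[OF g]
  note [measurable] = F(5) G(5)
  obtain y where y: "conv_deviation g f y \<le> s / 2" "conv_deviation g f (y + z) \<le> s / 2"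
    using large_mass_translate_meets[OF G(1,2,3) _ small_deviation_large_mass[OF g f s] z] by auto
  have "translation_dist f ((y + z) - y) \<le> conv_deviation g f (y + z) + conv_deviation g f y"
    unfolding conv_deviation_def by (intro translation_dist_diff_le integrable_conv F G)
  then show ?thesis using y by simp
qed

text \<open>The two averages make \<open>{z. translation_dist f z \<le> 1 / 2}\<close> coincide with the
  much smaller ball \<open>{z. translation_dist f z \<le> s}\<close>, so this set is a subgroup.\<close>
lemma small_deviation_almost_invariant:
  assumes conn: "connected (UNIV :: 'g set)"
    and g: "finite_entropy_density g" and f: "finite_entropy_density f"
    and s: "0 < s" "s \<le> 1 / 8"
    and gf: "(\<integral>y. g y * conv_deviation g f y \<partial>\<mu>) \<le> s / 32"
    and fg: "(\<integral>y. f y * conv_deviation f g y \<partial>\<mu>) \<le> s / 32"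
  shows "translation_dist f z \<le> s"
proof -
  note F = finite_entropy_densityD[OF f] and G = finite_entropy_densityD[OF g]
  note [measurable] = F(5) G(5)
  define H where "H = {z. translation_dist f z \<le> 1 / 2}"
  have [measurable]: "H \<in> sets borel" unfolding H_def by measurable
  \<comment> \<open>From radius 1/2 for f to radius s for g, and, as s <= 1/2, back to radius s for
    f.\<close>
  have Hs: "translation_dist f z \<le> s" if "z \<in> H" for z
  proof -
    have "translation_dist g z \<le> s"
      using small_translation_dist_improves[OF f g s(1) fg] that by (simp add: H_def)
    then show ?thesis using small_translation_dist_improves[OF g f s(1) gf] s by simp
  qed
  \<comment> \<open>The triangle inequality gives 2 s <= 1/4, which is again below the radius 1/2
    that defines \<open>H\<close>.\<close>
  have diff: "x - y \<in> H" if "x \<in> H" "y \<in> H" for x y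
    using translation_dist_diff_le[OF F(2) F(2), of x y] Hs[OF that(1)] Hs[OF that(2)] s
    by (simp add: H_def translation_dist_def[symmetric])
  define T where "T = {y. conv_deviation g f y \<le> s / 2}"
  have [measurable]: "T \<in> sets borel" unfolding T_def by measurable
  have mass: "3 / 4 < (\<integral>y. g y * indicator T y \<partial>\<mu>)"
    using small_deviation_large_mass[OF g f s(1) gf] by (simp add: T_def)
  have "T \<noteq> {}" using mass by auto
  then obtain t where t: "t \<in> T" by auto
  \<comment> \<open>Thus \<open>H\<close> contains a translate of \<open>T\<close>, and
    \<open>T\<close> is not a null set because it carries g-mass.\<close>
  have sub: "T \<subseteq> (\<lambda>x. x + - t) -` H"
  proof
    fix y assume "y \<in> T"
    have "translation_dist f (y - t) \<le> conv_deviation g f y + conv_deviation g f t"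
      unfolding conv_deviation_def by (intro translation_dist_diff_le integrable_conv F G)
    then show "y \<in> (\<lambda>x. x + - t) -` H" using t \<open>y \<in> T\<close> s by (simp add: T_def H_def)
  qed
  have "0 < measure \<mu> H"
  proof (rule ccontr)
    assume "\<not> ?thesis"
    then have "measure \<mu> H = 0" using measure_nonneg[of \<mu> H] by linarith
    then have "(\<integral>\<^sup>+x. indicator H (x + - t) \<partial>\<mu>) = 0"
      by (subst nn_integral_translate) (auto simp: emeasure_eq_measure sets_haar)
    then have "AE x in \<mu>. (indicator H (x + - t) :: ennreal) = 0"
      by (subst (asm) nn_integral_0_iff_AE) measurable
    then have "AE x in \<mu>. g x * indicator T x = 0"
      by eventually_elim (use sub in \<open>auto simp: indicator_def split: if_splits\<close>)
    then have "(\<integral>y. g y * indicator T y \<partial>\<mu>) = 0" by (rule integral_eq_zero_AE)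
    then show False using mass by simp
  qed
  then have "H = UNIV" by (intro measurable_subgroup_eq_UNIV conn diff) auto
  then show ?thesis using Hs by simp
qed

text \<open>The constant 1 is the average over z of the translates f(x - z), so the L1 distance of f
  to 1 is at most the average of \<open>translation_dist f\<close>.\<close>

lemma almost_invariant_excess_le:
  assumes f: "finite_entropy_density f" and s: "\<And>z. translation_dist f z \<le> s"
  shows "(\<integral>x. max (f x - 1) 0 \<partial>\<mu>) \<le> s / 2"
proof -
  note F = finite_entropy_densityD[OF f]
  note [measurable] = F(5)
  have p1: "integrable (\<mu> \<Otimes>\<^sub>M \<mu>) (\<lambda>(z, x). f (x - z))"
    using integrable_pair_conv[of "\<lambda>_. 1" f] F(2) by simp
  have p2: "integrable (\<mu> \<Otimes>\<^sub>M \<mu>) (\<lambda>(z, x). f x)"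
    by (rule Fubini_integrable) (use F in auto)
  have "integrable (\<mu> \<Otimes>\<^sub>M \<mu>) (\<lambda>p. (case p of (z, x) \<Rightarrow> f (x - z)) - (case p of (z, x) \<Rightarrow> f x))"
    by (intro Bochner_Integration.integrable_diff p1 p2)
  then have pair: "integrable (\<mu> \<Otimes>\<^sub>M \<mu>) (\<lambda>(z, x). \<bar>f (x - z) - f x\<bar>)"
    by (drule_tac integrable_abs) (simp add: case_prod_beta')
  have "(\<integral>x. \<bar>f x - 1\<bar> \<partial>\<mu>) \<le> (\<integral>x. (\<integral>z. \<bar>f (x - z) - f x\<bar> \<partial>\<mu>) \<partial>\<mu>)"
  proof (rule integral_mono)
    fix x
    have "f x - 1 = - (\<integral>z. f (x - z) - f x \<partial>\<mu>)"
      using integral_reflect[of f x] integrable_reflect[OF F(2), of x] F(3) prob_space by simp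
    then show "\<bar>f x - 1\<bar> \<le> (\<integral>z. \<bar>f (x - z) - f x\<bar> \<partial>\<mu>)"
      using integral_abs_bound[of \<mu> "\<lambda>z. f (x - z) - f x"] by simp
  next
    show "integrable \<mu> (\<lambda>x. \<integral>z. \<bar>f (x - z) - f x\<bar> \<partial>\<mu>)"
      using integrable_snd[OF pair] by simp
  qed (use F in auto)
  also have "\<dots> = (\<integral>z. translation_dist f z \<partial>\<mu>)"
    using Fubini_integral[OF pair] by (simp add: translation_dist_def)
  also have "\<dots> \<le> (\<integral>z. s \<partial>\<mu>)"
    using integrable_fst[OF pair] s by (intro integral_mono) (auto simp: translation_dist_def)
  finally have "(\<integral>x. \<bar>f x - 1\<bar> \<partial>\<mu>) \<le> s" using prob_space by simp
  \<comment> \<open>Since f - 1 has integral 0, its positive part carries half of its L1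
    norm.\<close>
  moreover have "(\<integral>x. max (f x - 1) 0 \<partial>\<mu>) = (\<integral>x. (\<bar>f x - 1\<bar> + (f x - 1)) / 2 \<partial>\<mu>)"
    by (intro Bochner_Integration.integral_cong) (auto simp: max_def abs_if)
  moreover have "\<dots> = (\<integral>x. \<bar>f x - 1\<bar> \<partial>\<mu>) / 2"
    using F(2,3) prob_space by simp
  ultimately show ?thesis by simp
qed

lemma rel_entropy_nonneg: "finite_entropy_density f \<Longrightarrow> 0 \<le> rel_entropy f"
  unfolding rel_entropy_def by (intro Bochner_Integration.integral_nonneg ent_fun_nonneg finite_entropy_densityD)

text \<open>The constant is 8192 = 2 * 64^2: a deficit d below s^2/8192 makes 2 d smaller than l^2
  for l = s/64, so both errors in \<open>rel_entropy_conv\<close> are of the same size.\<close>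

lemma rel_entropy_conv_gap:
  assumes conn: "connected (UNIV :: 'g set)"
    and f: "finite_entropy_density f" and g: "finite_entropy_density g"
  shows "(min (max (rel_entropy f) (rel_entropy g)) (1 / 8))\<^sup>2 / 8192
    \<le> (rel_entropy f + rel_entropy g) / 2 - rel_entropy (conv g f)"
proof (rule ccontr)
  note F = finite_entropy_densityD[OF f] and G = finite_entropy_densityD[OF g]
  define t where "t = max (rel_entropy f) (rel_entropy g)"
  define s where "s = min t (1 / 8)"
  define d where "d = (rel_entropy f + rel_entropy g) / 2 - rel_entropy (conv g f)"
  assume "\<not> ?thesis"
  then have d: "d < s\<^sup>2 / 8192" by (simp add: d_def s_def t_def)
  have comm: "conv f g = conv g f" by (intro ext conv_commute F G)
  have le: "rel_entropy (conv g f) \<le> rel_entropy f" "rel_entropy (conv g f) \<le> rel_entropy g"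
    using rel_entropy_conv[OF g f, of 0] rel_entropy_conv[OF f g, of 0] by (simp_all add: comm)
  then have d0: "0 \<le> d" by (simp add: d_def)
  have t0: "0 \<le> t" using rel_entropy_nonneg[OF f] by (simp add: t_def)
  have s0: "0 < s"
  proof (rule ccontr)
    assume "\<not> 0 < s"
    then have "s = 0" using t0 by (auto simp: s_def)
    then show False using d d0 by simp
  qed
  have s8: "s \<le> 1 / 8" "s \<le> t" by (auto simp: s_def)
  have small: "(\<integral>y. g' y * conv_deviation g' f' y \<partial>\<mu>) \<le> s / 32"
    if "finite_entropy_density f'" "finite_entropy_density g'"
      "rel_entropy f' - rel_entropy (conv g' f') \<le> 2 * d" for f' g'
  proof -
    \<comment> \<open>With l = s/64 the right side is at most 2 l^2 = l (s/32), and dividing by l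
      leaves the bound s/32.\<close>
    have "s / 64 * (\<integral>y. g' y * conv_deviation g' f' y \<partial>\<mu>) \<le> 2 * d + (s / 64)\<^sup>2"
      using rel_entropy_conv[OF that(2,1), of "s / 64"] that(3) s0 s8 by simp
    also have "\<dots> \<le> s / 64 * (s / 32)" using d by (simp add: power2_eq_square)
    finally show ?thesis using s0 by (simp only: mult_le_cancel_left_pos)
  qed
  \<comment> \<open>The two entropy drops are nonnegative with average d, so each is at most 2
    d.\<close>
  have "translation_dist f z \<le> s" for z
    using le by (intro small_deviation_almost_invariant[OF conn g f s0 s8(1)] small f g)
      (auto simp: d_def comm)
  from almost_invariant_excess_le[OF f this]
  have p: "(\<integral>x. max (f x - 1) 0 \<partial>\<mu>) \<le> s / 2" .
  have "rel_entropy (conv g f) \<le> (\<integral>x. max (f x - 1) 0 \<partial>\<mu>) * (1 + rel_entropy g)"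
    by (rule rel_entropy_conv_le[OF g f])
  also have "\<dots> \<le> s / 2 * (1 + t)"
    using p s0 rel_entropy_nonneg[OF g] by (intro mult_mono) (auto simp: t_def)
  finally have "rel_entropy (conv g f) \<le> s / 2 * (1 + t)" .
  moreover have "t \<le> rel_entropy (conv g f) + 2 * d"
    using le by (auto simp: t_def max_def d_def diff_divide_distrib add_divide_distrib)
  moreover have "s\<^sup>2 \<le> 1 / 8 * s" using s0 s8 by (simp add: power2_eq_square)
  moreover have "s / 2 * t \<le> 1 / 16 * t" using s8 t0 by (intro mult_right_mono) auto
  \<comment> \<open>Together: t <= s/2 + t/16 + 2 d with 2 d < s^2/4096 <= s/32768. As 0 < s <= t,
    the right side is less than t.\<close>
  ultimately show False using d s8 s0 by (simp add: distrib_left)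
qed

end

section \<open>Entropies of random variables\<close>

text \<open>Dropping the negative term of the numerator and 8 u^4 in the denominator leaves u^5/16,
  and u <= 1/8 turns u^3/16 into at most 1/(512 * 16) = 1/8192.\<close>

lemma gap_le:
  assumes "0 \<le> t"
  shows "gap (- t) \<le> (min t (1 / 8))\<^sup>2 / 8192"
proof -
  have main: "gap_formula (- u) \<le> u\<^sup>2 / 8192" if u: "0 \<le> u" "u \<le> 1 / 8" for u
  proof -
    have "gap_formula (- u) = (u ^ 5 - 4 * u ^ 6) / (16 + 8 * u ^ 4)"
      by (simp add: gap_formula_def)
    also have "\<dots> \<le> u ^ 5 / 16"
      using u by (intro frac_le) auto
    also have "\<dots> = u\<^sup>2 * u ^ 3 / 16" by (simp add: power_add[symmetric])
    also have "\<dots> \<le> u\<^sup>2 * (1 / 8) ^ 3 / 16"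
      using u by (intro divide_right_mono mult_left_mono power_mono) auto
    finally show ?thesis by (simp add: power3_eq_cube)
  qed
  show ?thesis
  proof (cases "t \<le> 1 / 8")
    case True
    then show ?thesis using main[of t] assms by (simp add: gap_def min_def)
  next
    case False
    then show ?thesis using main[of "1/8"] by (simp add: gap_def min_def)
  qed
qed

text \<open>Shows the sign and the zeros: the second root -1/4 lies outside the interval from -1/8
  to 0.\<close>

lemma gap_formula_factor: "gap_formula x = (- x) ^ 5 * (1 + 4 * x) / (16 + 8 * x ^ 4)"
  by (simp add: gap_formula_def algebra_simps power_numeral_reduce)

lemma gap_formula_denominator_pos: "0 < 16 + 8 * (x::real) ^ 4"
proof -
  have "0 \<le> x ^ 4" by simp
  then show ?thesis by linarith
qed

lemma gap_formula_nonneg: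
  assumes "- 1 / 8 \<le> x" "x \<le> 0"
  shows "0 \<le> gap_formula x"
proof -
  have "0 \<le> (- x) ^ 5" using assms by (intro zero_le_power) simp
  moreover have "0 \<le> 1 + 4 * x" using assms by simp
  ultimately show ?thesis
    unfolding gap_formula_factor
    by (intro divide_nonneg_pos mult_nonneg_nonneg gap_formula_denominator_pos)
qed

lemma gap_formula_eq_0: "- 1 / 8 \<le> x \<Longrightarrow> gap_formula x = 0 \<longleftrightarrow> x = 0"
  unfolding gap_formula_factor using gap_formula_denominator_pos[of x] by auto

lemma gap_nonneg: "x \<le> 0 \<Longrightarrow> 0 \<le> gap x"
  unfolding gap_def by (auto intro!: gap_formula_nonneg)

lemma gap_eq_0_iff: "x \<le> 0 \<Longrightarrow> gap x = 0 \<longleftrightarrow> x = 0"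
  unfolding gap_def using gap_formula_eq_0[of "- 1 / 8"] by (auto simp: gap_formula_eq_0)

lemma continuous_on_gap: "continuous_on A gap"
proof -
  \<comment> \<open>Clamping the argument at -1/8 avoids gluing two continuous pieces.\<close>
  have eq: "gap = (\<lambda>x. gap_formula (max x (- 1 / 8)))"
    by (auto simp: gap_def max_def)
  have "continuous_on UNIV gap_formula"
    unfolding gap_formula_def by (intro continuous_intros ballI less_imp_neq[THEN not_sym] gap_formula_denominator_pos)
  then have "continuous_on A (\<lambda>x. gap_formula (max x (- 1 / 8)))"
    by (rule continuous_on_compose2) (auto intro!: continuous_intros)
  then show ?thesis unfolding eq .
qed

section \<open>Passage from random variables to densities\<close>

context compact_haar
begin

lemma law_entropy_finite:
  assumes "finite_entropy_density f"
  shows "law_entropy \<mu> (density \<mu> (\<lambda>x. ennreal (f x))) = ereal (- rel_entropy f)"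
proof -
  note F = finite_entropy_densityD[OF assms]
  note [measurable] = F(5)
  have eq: "f x * ln (f x) = ent_fun (f x) + f x - 1" for x by (simp add: ent_fun_def)
  have i: "integrable \<mu> (\<lambda>x. f x * ln (f x))" unfolding eq using F by simp
  have fin: "(\<integral>\<^sup>+x. ennreal (f x * ln (f x)) \<partial>\<mu>) \<noteq> \<infinity>"
    "(\<integral>\<^sup>+x. ennreal (- (f x * ln (f x))) \<partial>\<mu>) \<noteq> \<infinity>"
    using i unfolding real_integrable_def by auto
  obtain p where p: "0 \<le> p" "(\<integral>\<^sup>+x. ennreal (f x * ln (f x)) \<partial>\<mu>) = ennreal p"
    using fin(1) by (cases "\<integral>\<^sup>+x. ennreal (f x * ln (f x)) \<partial>\<mu>") auto
  obtain n where n: "0 \<le> n" "(\<integral>\<^sup>+x. ennreal (- (f x * ln (f x))) \<partial>\<mu>) = ennreal n"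
    using fin(2) by (cases "\<integral>\<^sup>+x. ennreal (- (f x * ln (f x))) \<partial>\<mu>") auto
  have "ext_integral \<mu> (\<lambda>x. f x * ln (f x)) = ereal (\<integral>x. f x * ln (f x) \<partial>\<mu>)"
    unfolding ext_integral_def real_lebesgue_integral_def[OF i] p n using p(1) n(1) by simp
  also have "(\<integral>x. f x * ln (f x) \<partial>\<mu>) = rel_entropy f"
    unfolding eq rel_entropy_def using F prob_space by simp
  finally show ?thesis
    by (subst law_entropy_density[OF prob_space_axioms _ F(1) refl]) auto
qed

text \<open>The tangent at 1 bounds the negative part of f ln f by 1, so only the positive part
  could have infinite integral, and that would make the entropy minus infinity.\<close>

lemma finite_entropy_densityI:
  assumes f: "\<And>x. 0 \<le> f x" "integrable \<mu> f" "(\<integral>x. f x \<partial>\<mu>) = 1"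
    and fin: "law_entropy \<mu> (density \<mu> (\<lambda>x. ennreal (f x))) > - \<infinity>"
  shows "finite_entropy_density f"
proof -
  note [measurable] = integrable_haar_measurable[OF f(2)]
  have neg: "(\<integral>\<^sup>+x. ennreal (- (f x * ln (f x))) \<partial>\<mu>) \<le> 1"
  proof -
    have "- (f x * ln (f x)) \<le> 1" for x
      using mult_ln_ge_tangent[of "f x" 0] f(1)[of x] by simp
    then have "(\<integral>\<^sup>+x. ennreal (- (f x * ln (f x))) \<partial>\<mu>) \<le> (\<integral>\<^sup>+x. 1 \<partial>\<mu>)"
      by (intro nn_integral_mono) (metis ennreal_1 ennreal_leI)
    then show ?thesis using emeasure_space_1 by simp
  qed
  have "ext_integral \<mu> (\<lambda>x. f x * ln (f x)) < \<infinity>"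
    using fin by (subst (asm) law_entropy_density[OF prob_space_axioms _ f(1) refl])
      (auto simp: ereal_uminus_less_reorder)
  then have "(\<integral>\<^sup>+x. ennreal (f x * ln (f x)) \<partial>\<mu>) \<noteq> \<infinity>"
    using neg unfolding ext_integral_def
    by (cases "\<integral>\<^sup>+x. ennreal (- (f x * ln (f x))) \<partial>\<mu>") (auto simp: top_unique)
  moreover have "(\<integral>\<^sup>+x. ennreal (- (f x * ln (f x))) \<partial>\<mu>) \<noteq> \<infinity>"
    using neg by (auto simp: top_unique)
  ultimately have "integrable \<mu> (\<lambda>x. f x * ln (f x))"
    unfolding real_integrable_def by auto
  then have "integrable \<mu> (\<lambda>x. ent_fun (f x))" unfolding ent_fun_def using f(2) by simp
  then show ?thesis unfolding finite_entropy_density_def using f by auto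
qed

lemma finite_entropy_obtain_density:
  assumes M: "prob_space M" and [measurable]: "X \<in> borel_measurable M"
    and fin: "entropy_wrt \<mu> M X > - \<infinity>"
  obtains f where "finite_entropy_density f" "distr M \<mu> X = density \<mu> (\<lambda>x. ennreal (f x))"
    "entropy_wrt \<mu> M X = ereal (- rel_entropy f)"
proof -
  have X: "X \<in> measurable M \<mu>" by measurable
  interpret N: prob_space "distr M \<mu> X" by (rule prob_space.prob_space_distr[OF M X])
  obtain h where [measurable]: "h \<in> borel_measurable \<mu>" and h: "distr M \<mu> X = density \<mu> h"
    using fin unfolding entropy_wrt_def law_entropy_def by (auto split: if_splits)
  define f where "f x = enn2real (h x)" for x
  have [measurable]: "f \<in> borel_measurable borel" unfolding f_def by measurable
  have h1: "(\<integral>\<^sup>+x. h x \<partial>\<mu>) = 1"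
    using N.emeasure_space_1 emeasure_density[of h \<mu> UNIV] by (simp add: h sets_haar)
  then have "AE x in \<mu>. h x \<noteq> \<infinity>" by (intro nn_integral_noteq_infinite) auto
  then have hf: "AE x in \<mu>. h x = ennreal (f x)"
    by eventually_elim (simp add: f_def less_top)
  have d: "distr M \<mu> X = density \<mu> (\<lambda>x. ennreal (f x))"
    unfolding h using hf by (intro density_cong) (auto simp: f_def)
  have "(\<integral>\<^sup>+x. ennreal (f x) \<partial>\<mu>) = 1" using h1 nn_integral_cong_AE[OF hf] by simp
  then have int: "integrable \<mu> f \<and> (\<integral>x. f x \<partial>\<mu>) = 1"
    using nn_integral_eq_integrable[of f \<mu> 1] by (simp add: f_def[abs_def])
  then have fed: "finite_entropy_density f"
    using fin unfolding entropy_wrt_def d by (intro finite_entropy_densityI) (auto simp: f_def)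
  show thesis
    using that[OF fed d] law_entropy_finite[OF fed] by (simp add: entropy_wrt_def d)
qed

text \<open>Independence gives the joint density f(x) g(y); substitute x - y for x by invariance and
  exchange the integrals. The inner integral equals \<open>conv g f x\<close> only for almost every
  x.\<close>

lemma distr_sum_density:
  assumes M: "prob_space M"
    and XY [measurable]: "X \<in> borel_measurable M" "Y \<in> borel_measurable M"
    and ind: "prob_space.indep_var M borel X borel Y"
    and f: "finite_entropy_density f" "distr M \<mu> X = density \<mu> (\<lambda>x. ennreal (f x))"
    and g: "finite_entropy_density g" "distr M \<mu> Y = density \<mu> (\<lambda>x. ennreal (g x))"
  shows "distr M \<mu> (\<lambda>w. X w + Y w) = density \<mu> (\<lambda>x. ennreal (conv g f x))"
proof (rule measure_eqI)
  interpret M: prob_space M by fact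
  note F = finite_entropy_densityD[OF f(1)] and G = finite_entropy_densityD[OF g(1)]
  note [measurable] = F(5) G(5)
  fix A assume "A \<in> sets (distr M \<mu> (\<lambda>w. X w + Y w))"
  then have A [measurable]: "A \<in> sets borel" by (simp add: sets_haar)
  have joint: "distr M (borel \<Otimes>\<^sub>M borel) (\<lambda>w. (X w, Y w))
      = density (\<mu> \<Otimes>\<^sub>M \<mu>) (\<lambda>(x, y). ennreal (f x) * ennreal (g y))"
  proof -
    \<comment> \<open>Independence is stated over \<open>borel\<close> and entropy over \<mu>; the
      push-forwards agree because the sigma-algebras do.\<close>
    have "distr M borel X = distr M \<mu> X" "distr M borel Y = distr M \<mu> Y"
      by (auto intro!: distr_cong simp: sets_haar)
    then have "distr M (borel \<Otimes>\<^sub>M borel) (\<lambda>w. (X w, Y w))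
        = density \<mu> (\<lambda>x. ennreal (f x)) \<Otimes>\<^sub>M density \<mu> (\<lambda>x. ennreal (g x))"
      using ind M.indep_var_distribution_eq[of borel X borel Y] f(2) g(2) by simp
    also have "\<dots> = density (\<mu> \<Otimes>\<^sub>M \<mu>) (\<lambda>(x, y). ennreal (f x) * ennreal (g y))"
    proof (rule pair_measure_density)
      interpret N: prob_space "distr M \<mu> Y" by (rule M.prob_space_distr) measurable
      show "sigma_finite_measure (density \<mu> (\<lambda>x. ennreal (g x)))"
        using N.sigma_finite_measure_axioms g(2) by simp
    qed (use prob_space_imp_sigma_finite[OF prob_space_axioms] in auto)
    finally show ?thesis .
  qed
  have "emeasure (distr M \<mu> (\<lambda>w. X w + Y w)) A = (\<integral>\<^sup>+w. indicator A (X w + Y w) \<partial>M)"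
    by (subst nn_integral_indicator[symmetric], simp add: sets_haar, subst nn_integral_distr) auto
  also have "\<dots> = (\<integral>\<^sup>+p. indicator A (fst p + snd p) \<partial>distr M (borel \<Otimes>\<^sub>M borel) (\<lambda>w. (X w, Y w)))"
    by (subst nn_integral_distr) auto
  also have "\<dots> = (\<integral>\<^sup>+p. (case p of (x, y) \<Rightarrow> ennreal (f x) * ennreal (g y)) * indicator A (fst p + snd p) \<partial>(\<mu> \<Otimes>\<^sub>M \<mu>))"
    unfolding joint by (rule nn_integral_density) measurable
  also have "\<dots> = (\<integral>\<^sup>+y. (\<integral>\<^sup>+x. ennreal (f x) * ennreal (g y) * indicator A (x + y) \<partial>\<mu>) \<partial>\<mu>)"
    by (subst nn_integral_snd[symmetric]) auto
  also have "\<dots> = (\<integral>\<^sup>+y. (\<integral>\<^sup>+x. ennreal (f (x - y)) * ennreal (g y) * indicator A x \<partial>\<mu>) \<partial>\<mu>)"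
  proof (rule nn_integral_cong)
    fix y
    show "(\<integral>\<^sup>+x. ennreal (f x) * ennreal (g y) * indicator A (x + y) \<partial>\<mu>)
        = (\<integral>\<^sup>+x. ennreal (f (x - y)) * ennreal (g y) * indicator A x \<partial>\<mu>)"
      using nn_integral_translate[of "\<lambda>x. ennreal (f (x - y)) * ennreal (g y) * indicator A x" y]
      by simp
  qed
  also have "\<dots> = (\<integral>\<^sup>+x. (\<integral>\<^sup>+y. ennreal (f (x - y)) * ennreal (g y) * indicator A x \<partial>\<mu>) \<partial>\<mu>)"
    by (rule Fubini') measurable
  also have "\<dots> = (\<integral>\<^sup>+x. ennreal (conv g f x) * indicator A x \<partial>\<mu>)"
  proof (rule nn_integral_cong_AE)
    show "AE x in \<mu>. (\<integral>\<^sup>+y. ennreal (f (x - y)) * ennreal (g y) * indicator A x \<partial>\<mu>)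
        = ennreal (conv g f x) * indicator A x"
      using AE_integrable_conv[OF G(2) F(2)]
    proof eventually_elim
      case (elim x)
      have "(\<integral>\<^sup>+y. ennreal (g y * f (x - y)) \<partial>\<mu>) = ennreal (conv g f x)"
        unfolding conv_def using elim F(1) G(1) by (intro nn_integral_eq_integral) auto
      then show ?case
        by (subst nn_integral_multc) (auto simp: ennreal_mult F(1) G(1) mult.commute)
    qed
  qed
  also have "\<dots> = emeasure (density \<mu> (\<lambda>x. ennreal (conv g f x))) A"
    by (subst emeasure_density) (auto simp: sets_haar)
  finally show "emeasure (distr M \<mu> (\<lambda>w. X w + Y w)) A
      = emeasure (density \<mu> (\<lambda>x. ennreal (conv g f x))) A" .
qed simp

lemma entropy_sum_gap:
  assumes conn: "connected (UNIV :: 'g set)" and M: "prob_space M"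
    and X: "X \<in> borel_measurable M" and Y: "Y \<in> borel_measurable M"
    and ind: "prob_space.indep_var M borel X borel Y"
    and fin: "entropy_wrt \<mu> M X > - \<infinity>" "entropy_wrt \<mu> M Y > - \<infinity>"
  shows "ereal (max (gap (real_of_ereal (entropy_wrt \<mu> M X))) (gap (real_of_ereal (entropy_wrt \<mu> M Y))))
    \<le> entropy_wrt \<mu> M (\<lambda>w. X w + Y w) - ereal (1 / 2) * entropy_wrt \<mu> M X - ereal (1 / 2) * entropy_wrt \<mu> M Y"
proof -
  obtain f where f: "finite_entropy_density f" "distr M \<mu> X = density \<mu> (\<lambda>x. ennreal (f x))"
    "entropy_wrt \<mu> M X = ereal (- rel_entropy f)"
    by (rule finite_entropy_obtain_density[OF M X fin(1)])
  obtain g where g: "finite_entropy_density g" "distr M \<mu> Y = density \<mu> (\<lambda>x. ennreal (g x))"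
    "entropy_wrt \<mu> M Y = ereal (- rel_entropy g)"
    by (rule finite_entropy_obtain_density[OF M Y fin(2)])
  have sum: "entropy_wrt \<mu> M (\<lambda>w. X w + Y w) = ereal (- rel_entropy (conv g f))"
    unfolding entropy_wrt_def distr_sum_density[OF M X Y ind f(1,2) g(1,2)]
    by (rule law_entropy_finite[OF finite_entropy_density_conv[OF g(1) f(1)]])
  \<comment> \<open>The smaller of the two relative entropies is compared with the larger through
    the increasing quadratic bound, so monotonicity of \<open>gap\<close> does not have to be
    studied.\<close>
  have mono: "gap (- a) \<le> (min (max (rel_entropy f) (rel_entropy g)) (1 / 8))\<^sup>2 / 8192"
    if "0 \<le> a" "a \<le> max (rel_entropy f) (rel_entropy g)" for a
  proof -
    have "(min a (1 / 8))\<^sup>2 \<le> (min (max (rel_entropy f) (rel_entropy g)) (1 / 8))\<^sup>2"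
      using that by (intro power_mono) auto
    then show ?thesis using gap_le[OF that(1)] by simp
  qed
  have "max (gap (- rel_entropy f)) (gap (- rel_entropy g))
      \<le> (min (max (rel_entropy f) (rel_entropy g)) (1 / 8))\<^sup>2 / 8192"
    by (intro max.boundedI mono) (auto simp: rel_entropy_nonneg f(1) g(1))
  also have "\<dots> \<le> (rel_entropy f + rel_entropy g) / 2 - rel_entropy (conv g f)"
    by (rule rel_entropy_conv_gap[OF conn f(1) g(1)])
  finally have "ereal (max (gap (- rel_entropy f)) (gap (- rel_entropy g)))
      \<le> ereal ((rel_entropy f + rel_entropy g) / 2 - rel_entropy (conv g f))"
    by (simp only: ereal_less_eq)
  also have "\<dots> = ereal (- rel_entropy (conv g f)) - ereal (1 / 2) * ereal (- rel_entropy f)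
      - ereal (1 / 2) * ereal (- rel_entropy g)"
    by (simp add: field_simps)
  finally show ?thesis by (simp only: sum f(3) g(3) real_of_ereal.simps)
qed

end

text \<open>\<open>real_of_ereal\<close> would send minus infinity to 0, but the finiteness
  hypotheses ensure that it only meets real values here.\<close>

theorem theorem2p10:
  shows "continuous_on {..0} gap \<and> (\<forall>x\<le>0. 0 \<le> gap x) \<and> (\<forall>x\<le>0. gap x = 0 \<longleftrightarrow> x = 0) \<and>
    (connected (UNIV :: 'g::{metric_space, topological_ab_group_add} set) \<longrightarrow>
     compact (UNIV :: 'g set) \<longrightarrow>
     (\<forall>(\<mu> :: 'g measure) (M :: 'w measure) (X :: 'w \<Rightarrow> 'g) (Y :: 'w \<Rightarrow> 'g).
        haar_prob \<mu> \<longrightarrow> prob_space M \<longrightarrow>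
        X \<in> borel_measurable M \<longrightarrow> Y \<in> borel_measurable M \<longrightarrow>
        prob_space.indep_var M borel X borel Y \<longrightarrow>
        entropy_wrt \<mu> M X > - \<infinity> \<longrightarrow> entropy_wrt \<mu> M Y > - \<infinity> \<longrightarrow>
        entropy_wrt \<mu> M (\<lambda>w. X w + Y w)
            - ereal (1 / 2) * entropy_wrt \<mu> M X - ereal (1 / 2) * entropy_wrt \<mu> M Y
          \<ge> ereal (max (gap (real_of_ereal (entropy_wrt \<mu> M X)))
                       (gap (real_of_ereal (entropy_wrt \<mu> M Y))))))"
proof (intro conjI allI impI)
  show "continuous_on {..0} gap" by (rule continuous_on_gap)
next
  fix \<mu> :: "'g measure" and M :: "'w measure" and X Y :: "'w \<Rightarrow> 'g"
  assume "connected (UNIV :: 'g set)" "compact (UNIV :: 'g set)" "haar_prob \<mu>" "prob_space M"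
    "X \<in> borel_measurable M" "Y \<in> borel_measurable M" "prob_space.indep_var M borel X borel Y"
    "- \<infinity> < entropy_wrt \<mu> M X" "- \<infinity> < entropy_wrt \<mu> M Y"
  then show "ereal (max (gap (real_of_ereal (entropy_wrt \<mu> M X))) (gap (real_of_ereal (entropy_wrt \<mu> M Y))))
      \<le> entropy_wrt \<mu> M (\<lambda>w. X w + Y w) - ereal (1 / 2) * entropy_wrt \<mu> M X
        - ereal (1 / 2) * entropy_wrt \<mu> M Y"
    by (intro compact_haar.entropy_sum_gap compact_haar.intro)
qed (simp_all add: gap_nonneg gap_eq_0_iff)

end
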